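(* The map $\natural : U^+_q \to \mathbb V$ sends $$E_{n\delta+\alpha_0} \mapsto q^{-2n}(q-q^{-1})^{2n}\, xC_n, \qquad E_{n\delta+\alpha_1} \mapsto q^{-2n}(q-q^{-1})^{2n}\, C_n y$$ for every integer $n\geq 0$, and $$E_{n\delta} \mapsto -q^{-2n}(q-q^{-1})^{2n-1}\, C_n$$ for every integer $n\geq 1$. Here $xC_n$ and $C_ny$ denote concatenation products (products in the free algebra $\mathbb V$).
   Context: $\mathbb F$ is a field and $q\in\mathbb F$ is nonzero and not a root of unity. All algebras are associative, unital, over $\mathbb F$. $\mathbb N=\{0,1,2,\ldots\}$ and $[n]_q=\frac{q^n-q^{-n}}{q-q^{-1}}$ for $n\in\mathbb N$. The algebra $U^+_q$ (positive part of $U_q(\widehat{\mathfrak{sl}}_2)$) is defined by generators $A,B$ and relations $A^3B-[3]_qA^2BA+[3]_qABA^2-BA^3=0$ and $B^3A-[3]_qB^2AB+[3]_qBAB^2-AB^3=0$. Elements $E_{n\delta+\alpha_0}$, $E_{n\delta+\alpha_1}$ ($n\ge 0$) and $E_{n\delta}$ ($n\geq 1$) of $U_q^+$ are defined recursively (Damiani) by $E_{\alpha_0}=A$, $E_{\alpha_1}=B$, $E_\delta=q^{-2}BA-AB$ and, for $n\geq 1$ (with $[a,b]=ab-ba$), $$E_{n\delta+\alpha_0}=\frac{[E_\delta,E_{(n-1)\delta+\alpha_0}]}{q+q^{-1}},\quad E_{n\delta+\alpha_1}=\frac{[E_{(n-1)\delta+\alpha_1},E_\delta]}{q+q^{-1}},\quad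 E_{n\delta}=q^{-2}E_{(n-1)\delta+\alpha_1}A-AE_{(n-1)\delta+\alpha_1}.$$ $\mathbb V$ is the free algebra on noncommuting generators $x,y$ (its product, concatenation, is written by juxtaposition). It has a basis of words $v_1\cdots v_n$ with $v_i\in\{x,y\}$, $n\ge0$; the word of length $0$ is $1$ (trivial). Put $\langle x,x\rangle=\langle y,y\rangle=2$, $\langle x,y\rangle=\langle y,x\rangle=-2$. The $q$-shuffle product $\star$ is the bilinear associative product on the vector space $\mathbb V$ with $1\star v=v\star 1=v$ and, for nontrivial words $u=u_1\cdots u_r$, $v=v_1\cdots v_s$, $$u\star v=u_1\bigl((u_2\cdots u_r)\star v\bigr)+v_1\bigl(u\star(v_2\cdots v_s)\bigr)q^{\langle u_1,v_1\rangle+\langle u_2,v_1\rangle+\cdots+\langle u_r,v_1\rangle}.$$ The vector space $\mathbb V$ with $\star$ is the $q$-shuffle algebra. In it, $x,y$ satisfy the defining relations of $U_q^+$ (with $A,B$ replaced by $x,y$), so there is a unique algebra homomorphism $\natural$ from $U_q^+$ to the $q$-shuffle algebra $\mathbb V$ sending $A\mapsto x$, $B\mapsto y$ (it is known to be injective). Put $\overline x=1$, $\overline y=-1$. A word $a_1\cdots a_m$ is Catalan if $\overline a_1+\cdots+\overline a_m=0$ and $\overline a_1+\cdots+\overline a_i\ge0$ for $1\le i\le m$. For $n\ge 0$ the $n$th Catalan element is $$C_n=\sum a_1a_2\cdots a_{2n}\,[1]_q[1+\overline a_1]_q[1+\overline a_1+\overline a_2]_q\cdots[1+\overline a_1+\cdots+\overline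 a_{2n}]_q,$$ the sum being over all Catalan words $a_1\cdots a_{2n}$ of length $2n$; in particular $C_0=1$. *)

theory Defs
  imports "HOL-Library.Poly_Mapping" "HOL-Algebra.QuotRing" "HOL-Algebra.Module"
begin

section \<open>Free algebras\<close>

text \<open>
  Words are lists, and the free algebra on \<open>'g\<close> over \<open>'f\<close> is the type of finitely supported
  functions \<open>'g list \<Rightarrow>\<^sub>0 'f\<close>. With the instance below, the convolution product \<open>*\<close> on
  \<open>\<Rightarrow>\<^sub>0\<close> supplied by the library is the bilinear extension of concatenation of words, and its
  unit \<open>1\<close> is the empty word.
\<close>

instantiation list :: (type) monoid_add
begin

definition zero_list :: "'a list" where "zero_list = []"

definition plus_list :: "'a list \<Rightarrow> 'a list \<Rightarrow> 'a list" where "plus_list = (@)"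

instance by standard (simp_all add: zero_list_def plus_list_def)

end

abbreviation word :: "'g list \<Rightarrow> ('g list \<Rightarrow>\<^sub>0 'f::field)" where
  "word w \<equiv> Poly_Mapping.single w 1"

definition scal :: "'f::field \<Rightarrow> ('g list \<Rightarrow>\<^sub>0 'f) \<Rightarrow> ('g list \<Rightarrow>\<^sub>0 'f)" where
  "scal c v = Poly_Mapping.map ((*) c) v"

section \<open>Algebras with carriers\<close>

text \<open>
  The record \<open>module\<close> (a ring with a scalar multiplication \<open>\<odot>\<close>) serves to describe
  associative unital algebras that need not be commutative; the scalars are a type of class
  \<open>field\<close>.
\<close>

definition free_alg :: "('f::field, 'g list \<Rightarrow>\<^sub>0 'f) module" where
  "free_alg = \<lparr>carrier = UNIV, mult = (*), one = 1, zero = 0, add = (+), smult = scal\<rparr>"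

definition quot_alg :: "('f, 'a, 'm) module_scheme \<Rightarrow> 'a set \<Rightarrow> ('f, 'a set) module" where
  "quot_alg M I = ring.extend (M Quot I)
     (module.fields (\<lambda>c Z. \<Union>z\<in>Z. I +>\<^bsub>M\<^esub> (c \<odot>\<^bsub>M\<^esub> z)))"

definition alg_hom :: "('f, 'a, 'm) module_scheme \<Rightarrow> ('f, 'b, 'n) module_scheme \<Rightarrow> ('a \<Rightarrow> 'b) set" where
  "alg_hom M N = {h \<in> ring_hom M N. \<forall>c. \<forall>z\<in>carrier M. h (c \<odot>\<^bsub>M\<^esub> z) = c \<odot>\<^bsub>N\<^esub> h z}"

section \<open>The algebra \<open>U\<^sub>q\<^sup>+\<close>\<close>

definition qint :: "'f::field \<Rightarrow> int \<Rightarrow> 'f" where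
  "qint q n = (q powi n - q powi (-n)) / (q - inverse q)"

datatype uq_gen = GenA | GenB

definition q_serre :: "'f::field \<Rightarrow> 'g \<Rightarrow> 'g \<Rightarrow> ('g list \<Rightarrow>\<^sub>0 'f)" where
  "q_serre q g h =
     (let a = word [g]; b = word [h] in
      a ^ 3 * b - scal (qint q 3) (a ^ 2 * b * a) + scal (qint q 3) (a * b * a ^ 2) - b * a ^ 3)"

text \<open>
  \<open>Idl\<close> is the two-sided ideal generated by a set. In a unital algebra it is automatically
  closed under scalars.
\<close>

definition uq_ideal :: "'f::field \<Rightarrow> (uq_gen list \<Rightarrow>\<^sub>0 'f) set" where
  "uq_ideal q = Idl\<^bsub>free_alg\<^esub> {q_serre q GenA GenB, q_serre q GenB GenA}"

definition Uq_plus :: "'f::field \<Rightarrow> ('f, (uq_gen list \<Rightarrow>\<^sub>0 'f) set) module" where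
  "Uq_plus q = quot_alg free_alg (uq_ideal q)"

definition uq_gen_elt :: "'f::field \<Rightarrow> uq_gen \<Rightarrow> (uq_gen list \<Rightarrow>\<^sub>0 'f) set" where
  "uq_gen_elt q g = uq_ideal q +>\<^bsub>free_alg\<^esub> word [g]"

abbreviation uqA :: "'f::field \<Rightarrow> (uq_gen list \<Rightarrow>\<^sub>0 'f) set" where
  "uqA q \<equiv> uq_gen_elt q GenA"

abbreviation uqB :: "'f::field \<Rightarrow> (uq_gen list \<Rightarrow>\<^sub>0 'f) set" where
  "uqB q \<equiv> uq_gen_elt q GenB"

section \<open>Damiani's elements\<close>

definition commutator :: "('a, 'm) ring_scheme \<Rightarrow> 'a \<Rightarrow> 'a \<Rightarrow> 'a" where
  "commutator R a b = a \<otimes>\<^bsub>R\<^esub> b \<ominus>\<^bsub>R\<^esub> b \<otimes>\<^bsub>R\<^esub> a"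

definition E_delta_1 :: "'f::field \<Rightarrow> (uq_gen list \<Rightarrow>\<^sub>0 'f) set" where
  "E_delta_1 q =
     (q powi (-2)) \<odot>\<^bsub>Uq_plus q\<^esub> (uqB q \<otimes>\<^bsub>Uq_plus q\<^esub> uqA q)
       \<ominus>\<^bsub>Uq_plus q\<^esub> uqA q \<otimes>\<^bsub>Uq_plus q\<^esub> uqB q"

primrec E_delta_alpha0 :: "'f::field \<Rightarrow> nat \<Rightarrow> (uq_gen list \<Rightarrow>\<^sub>0 'f) set" where
  "E_delta_alpha0 q 0 = uqA q"
| "E_delta_alpha0 q (Suc n) =
     inverse (q + inverse q) \<odot>\<^bsub>Uq_plus q\<^esub>
       commutator (Uq_plus q) (E_delta_1 q) (E_delta_alpha0 q n)"

primrec E_delta_alpha1 :: "'f::field \<Rightarrow> nat \<Rightarrow> (uq_gen list \<Rightarrow>\<^sub>0 'f) set" where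
  "E_delta_alpha1 q 0 = uqB q"
| "E_delta_alpha1 q (Suc n) =
     inverse (q + inverse q) \<odot>\<^bsub>Uq_plus q\<^esub>
       commutator (Uq_plus q) (E_delta_alpha1 q n) (E_delta_1 q)"

text \<open>\<open>E_delta q n\<close> is meaningful only for \<open>n \<ge> 1\<close>; for \<open>n = 1\<close> it is \<open>E_delta_1 q\<close>.\<close>

definition E_delta :: "'f::field \<Rightarrow> nat \<Rightarrow> (uq_gen list \<Rightarrow>\<^sub>0 'f) set" where
  "E_delta q n =
     (q powi (-2)) \<odot>\<^bsub>Uq_plus q\<^esub> (E_delta_alpha1 q (n - 1) \<otimes>\<^bsub>Uq_plus q\<^esub> uqA q)
       \<ominus>\<^bsub>Uq_plus q\<^esub> uqA q \<otimes>\<^bsub>Uq_plus q\<^esub> E_delta_alpha1 q (n - 1)"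

section \<open>The \<open>q\<close>-shuffle algebra\<close>

datatype letter = LetX | LetY

definition pairing :: "letter \<Rightarrow> letter \<Rightarrow> int" where
  "pairing a b = (if a = b then 2 else -2)"

fun shuffle_words :: "'f::field \<Rightarrow> letter list \<Rightarrow> letter list \<Rightarrow> (letter list \<Rightarrow>\<^sub>0 'f)" where
  "shuffle_words q [] v = word v"
| "shuffle_words q (a # u) [] = word (a # u)"
| "shuffle_words q (a # u) (b # v) =
     word [a] * shuffle_words q u (b # v)
     + scal (q powi (\<Sum>c\<leftarrow>a # u. pairing c b)) (word [b] * shuffle_words q (a # u) v)"

definition q_shuffle ::
  "'f::field \<Rightarrow> (letter list \<Rightarrow>\<^sub>0 'f) \<Rightarrow> (letter list \<Rightarrow>\<^sub>0 'f) \<Rightarrow> (letter list \<Rightarrow>\<^sub>0 'f)" where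
  "q_shuffle q f g =
     (\<Sum>u\<in>Poly_Mapping.keys f. \<Sum>v\<in>Poly_Mapping.keys g.
        scal (Poly_Mapping.lookup f u * Poly_Mapping.lookup g v) (shuffle_words q u v))"

definition shuffle_alg :: "'f::field \<Rightarrow> ('f, letter list \<Rightarrow>\<^sub>0 'f) module" where
  "shuffle_alg q =
     \<lparr>carrier = UNIV, mult = q_shuffle q, one = 1, zero = 0, add = (+), smult = scal\<rparr>"

text \<open>
  HOL functions are total, so the homomorphism is unique only after fixing its values outside the
  carrier; this is the purpose of \<open>extensional\<close>.
\<close>

definition natural :: "'f::field \<Rightarrow> (uq_gen list \<Rightarrow>\<^sub>0 'f) set \<Rightarrow> (letter list \<Rightarrow>\<^sub>0 'f)" where
  "natural q = (THE h. h \<in> alg_hom (Uq_plus q) (shuffle_alg q)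
                     \<and> h \<in> extensional (carrier (Uq_plus q))
                     \<and> h (uqA q) = word [LetX] \<and> h (uqB q) = word [LetY])"

section \<open>Catalan elements\<close>

fun bar :: "letter \<Rightarrow> int" where
  "bar LetX = 1"
| "bar LetY = -1"

definition bar_sum :: "nat \<Rightarrow> letter list \<Rightarrow> int" where
  "bar_sum i w = (\<Sum>a\<leftarrow>take i w. bar a)"

definition catalan_word :: "letter list \<Rightarrow> bool" where
  "catalan_word w \<longleftrightarrow>
     bar_sum (length w) w = 0 \<and> (\<forall>i\<in>{1..length w}. 0 \<le> bar_sum i w)"

definition catalan_elt :: "'f::field \<Rightarrow> nat \<Rightarrow> (letter list \<Rightarrow>\<^sub>0 'f)" where
  "catalan_elt q n =
     (\<Sum>w | length w = 2 * n \<and> catalan_word w.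
        scal (\<Prod>i=0..2 * n. qint q (1 + bar_sum i w)) (word w))"

end

theory Submission
  imports Defs
begin

text \<open>
  Write \<open>x\<close>, \<open>y\<close> for the two letters, \<open>[n]\<close> for the \<open>q\<close>-integer, \<open>\<kappa> = q - q\<inverse>\<close>, and let juxtaposition be
  concatenation. The homomorphism sends \<open>E\<^sub>\<delta>\<close> to \<open>q\<^sup>-\<^sup>2 y \<star> x - x \<star> y\<close>, a multiple of the
  concatenation \<open>xy\<close>. Damiani's recursions therefore reduce the claim to three identities of the
  \<open>q\<close>-shuffle product: the commutators of \<open>xy\<close> with \<open>xC\<^sub>n\<close> and with \<open>C\<^sub>ny\<close>
  (\<open>XC_commutator_XY\<close>, \<open>CY_commutator_XY\<close>) are multiples of \<open>xC\<^sub>n\<^sub>+\<^sub>1\<close> and \<open>C\<^sub>n\<^sub>+\<^sub>1y\<close>, and a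
  \<open>q\<close>-commutator of \<open>x\<close> with \<open>C\<^sub>ny\<close> is a multiple of \<open>C\<^sub>n\<^sub>+\<^sub>1\<close> (\<open>X_shuffle_CY\<close>).

  Read a word as a lattice path, \<open>x\<close> being a step up and \<open>y\<close> a step down. Then \<open>C\<^sub>n\<close> is the sum of
  the paths of length \<open>2n\<close> from height \<open>0\<close> to height \<open>0\<close>, each weighted by the product of
  \<open>[1 + h]\<close> over the heights \<open>h\<close> it visits; a path that goes below \<open>0\<close> visits \<open>-1\<close> and has weight
  \<open>[0] = 0\<close>. The same sum is formed for an arbitrary starting height \<open>s\<close> (\<open>catalan_path\<close>). Removing
  the first step gives a recursion that fits the recursion of \<open>\<star>\<close> by first letters, so identities
  for all \<open>s\<close> can be proved by induction on the length. A \<open>q\<close>-commutator with a letter inserts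
  that letter at every place of a path, with a factor \<open>\<kappa> [2h + 2]\<close> if the height there is \<open>h\<close>, and
  since \<open>[2h + 2] = [h + 1] [h + 2] - [h] [h + 1]\<close>, the coefficient of each resulting path
  telescopes (\<open>catalan_path_shuffle_Y\<close>, \<open>letter_X_shuffle_catalan_path\<close>). The commutator with \<open>xy\<close>
  inserts two letters; here the outcome consists of two boundary terms (\<open>catalan_path_shuffle_XY\<close>)
  that both vanish for \<open>s = 0\<close>. Hence \<open>xy\<close> commutes with \<open>C\<^sub>n\<close>. Splitting off the first letter of
  \<open>xC\<^sub>n\<close>, or the last letter of \<open>C\<^sub>ny\<close>, reduces the two commutators to this fact and to the
  single-letter identities.

  The map itself is evaluation of noncommutative polynomials in the \<open>q\<close>-shuffle algebra. It is
  multiplicative because \<open>\<star>\<close> is associative, and it factors through the presented algebra because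
  \<open>x\<close> and \<open>y\<close> satisfy the cubic \<open>q\<close>-Serre relations.
\<close>

section \<open>Linear maps between spaces of words\<close>

lemma lookup_scal [simp]: "Poly_Mapping.lookup (scal c f) w = c * Poly_Mapping.lookup f w"
  unfolding scal_def by (simp add: Poly_Mapping.map.rep_eq when_def)

lemma scal_conv_mult: "scal c f = Poly_Mapping.single [] c * f"
  unfolding scal_def by (simp add: mult_map_scale_conv_mult zero_list_def)

lemma scal_add_right: "scal c (f + g) = scal c f + scal c g"
  by (simp add: scal_conv_mult distrib_left)

lemma scal_diff_right: "scal c (f - g) = scal c f - scal c g"
  by (simp add: scal_conv_mult right_diff_distrib)

lemma scal_add_left: "scal (c + d) f = scal c f + scal d f"
  by (rule poly_mapping_eqI) (simp add: lookup_add algebra_simps)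

lemma scal_sub_left: "scal (c - d) f = scal c f - scal d f"
  by (rule poly_mapping_eqI) (simp add: lookup_minus algebra_simps)

lemma scal_scal [simp]: "scal c (scal d f) = scal (c * d) f"
  by (rule poly_mapping_eqI) (simp add: algebra_simps)

lemma scal_one [simp]: "scal 1 f = f"
  by (rule poly_mapping_eqI) simp

lemma scal_zero_left [simp]: "scal 0 f = 0"
  by (rule poly_mapping_eqI) simp

lemma scal_zero [simp]: "scal c 0 = 0"
  by (rule poly_mapping_eqI) simp

lemma scal_sum: "scal c (\<Sum>i\<in>I. f i) = (\<Sum>i\<in>I. scal c (f i))"
  by (simp add: scal_conv_mult sum_distrib_left)

lemma word_Nil: "word [] = 1"
  by (simp flip: single_one add: zero_list_def)

lemma word_mult [simp]: "word u * word v = (word (u @ v) :: 'g list \<Rightarrow>\<^sub>0 'f::field)"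
  by (simp add: mult_single plus_list_def)

lemma word_Cons: "word (a # u) = (word [a] * word u :: 'g list \<Rightarrow>\<^sub>0 'f::field)"
  by simp

lemma scal_mult_left: "scal c f * g = scal c (f * g)"
  by (simp add: scal_conv_mult mult.assoc)

definition lin :: "(('g list \<Rightarrow>\<^sub>0 'f::field) \<Rightarrow> ('h list \<Rightarrow>\<^sub>0 'f)) \<Rightarrow> bool" where
  "lin A \<longleftrightarrow> (\<forall>f g. A (f + g) = A f + A g) \<and> (\<forall>c f. A (scal c f) = scal c (A f))"

lemma linI:
  assumes "\<And>f g. A (f + g) = A f + A g" "\<And>c f. A (scal c f) = scal c (A f)"
  shows "lin A"
  using assms by (simp add: lin_def)

lemma lin_add: "lin A \<Longrightarrow> A (f + g) = A f + A g"
  by (simp add: lin_def)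

lemma lin_scal: "lin A \<Longrightarrow> A (scal c f) = scal c (A f)"
  by (simp add: lin_def)

lemma lin_zero: "lin A \<Longrightarrow> A 0 = 0"
  using lin_scal[of A 0 0] by simp

lemma lin_diff: "lin A \<Longrightarrow> A (f - g) = A f - A g"
  using lin_add[of A "f - g" g] by simp

lemma lin_sum: "lin A \<Longrightarrow> A (\<Sum>i\<in>I. f i) = (\<Sum>i\<in>I. A (f i))"
  by (induction I rule: infinite_finite_induct) (simp_all add: lin_zero lin_add)

text \<open>
  Every element is the combination of its own words, so a linear map is determined by its values
  on the words that occur in its argument. Restricting to those words matters: identities of the
  \<open>q\<close>-shuffle product carry a power of \<open>q\<close> that depends on the weight of a word, and so extend
  only to homogeneous elements.
\<close>

lemma word_expansion:
  "f = (\<Sum>u\<in>Poly_Mapping.keys f. scal (Poly_Mapping.lookup f u) (word u))"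
proof (rule poly_mapping_eqI)
  fix w
  have "(\<Sum>u\<in>Poly_Mapping.keys f. Poly_Mapping.lookup f u * (1 when u = w))
      = (\<Sum>u\<in>Poly_Mapping.keys f. if u = w then Poly_Mapping.lookup f u else 0)"
    by (intro sum.cong) (auto simp: when_def)
  then show "Poly_Mapping.lookup f w = Poly_Mapping.lookup
      (\<Sum>u\<in>Poly_Mapping.keys f. scal (Poly_Mapping.lookup f u) (word u)) w"
    by (simp add: lookup_sum lookup_single in_keys_iff)
qed

lemma lin_expansion:
  assumes "lin A"
  shows "A f = (\<Sum>u\<in>Poly_Mapping.keys f. scal (Poly_Mapping.lookup f u) (A (word u)))"
  by (subst word_expansion[of f]) (simp add: lin_sum[OF assms] lin_scal[OF assms])

lemma lin_eq_on_words:
  assumes "lin A" "lin B" "\<And>u. u \<in> Poly_Mapping.keys f \<Longrightarrow> A (word u) = B (word u)"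
  shows "A f = B f"
  unfolding lin_expansion[OF assms(1), of f] lin_expansion[OF assms(2), of f]
  using assms(3) by simp

definition linear_extension ::
  "('g list \<Rightarrow> ('h list \<Rightarrow>\<^sub>0 'f::field)) \<Rightarrow> ('g list \<Rightarrow>\<^sub>0 'f) \<Rightarrow> ('h list \<Rightarrow>\<^sub>0 'f)" where
  "linear_extension \<phi> f = (\<Sum>u\<in>Poly_Mapping.keys f. scal (Poly_Mapping.lookup f u) (\<phi> u))"

lemma linear_extension_superset:
  assumes "finite S" "Poly_Mapping.keys f \<subseteq> S"
  shows "linear_extension \<phi> f = (\<Sum>u\<in>S. scal (Poly_Mapping.lookup f u) (\<phi> u))"
  unfolding linear_extension_def
  by (rule sum.mono_neutral_left) (use assms in \<open>auto simp: in_keys_iff\<close>)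

lemma lin_linear_extension: "lin (linear_extension \<phi>)"
proof (rule linI)
  fix f g :: "'a list \<Rightarrow>\<^sub>0 'b" and c
  let ?S = "Poly_Mapping.keys f \<union> Poly_Mapping.keys g"
  have "linear_extension \<phi> h = (\<Sum>u\<in>?S. scal (Poly_Mapping.lookup h u) (\<phi> u))"
    if "h \<in> {f, g, f + g}" for h
    by (rule linear_extension_superset) (use that keys_add[of f g] in auto)
  then show "linear_extension \<phi> (f + g) = linear_extension \<phi> f + linear_extension \<phi> g"
    by (simp add: lookup_add scal_add_left sum.distrib)
  have "linear_extension \<phi> (scal c f)
      = (\<Sum>u\<in>Poly_Mapping.keys f. scal (Poly_Mapping.lookup (scal c f) u) (\<phi> u))"
    by (rule linear_extension_superset) (auto simp: in_keys_iff)
  then show "linear_extension \<phi> (scal c f) = scal c (linear_extension \<phi> f)"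
    by (simp add: linear_extension_def scal_sum)
qed

lemma linear_extension_word [simp]: "linear_extension \<phi> (word u) = \<phi> u"
  by (simp add: linear_extension_def)

lemma lin_id: "lin (\<lambda>f. f)"
  by (rule linI) auto

lemma lin_comp: "lin A \<Longrightarrow> lin B \<Longrightarrow> lin (\<lambda>f. A (B f))"
  by (rule linI) (simp_all add: lin_add lin_scal)

lemma lin_add_fun: "lin A \<Longrightarrow> lin B \<Longrightarrow> lin (\<lambda>f. A f + B f)"
  by (rule linI) (simp_all add: lin_add lin_scal scal_add_right)

lemma lin_scal_fun: "lin A \<Longrightarrow> lin (\<lambda>f. scal c (A f))"
  by (rule linI) (simp_all add: lin_add lin_scal scal_add_right mult.commute)

lemma lin_mult_right: "lin A \<Longrightarrow> lin (\<lambda>f. A f * g)"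
  by (rule linI) (simp_all add: lin_add lin_scal distrib_right scal_mult_left)

lemma scal_central:
  fixes f :: "'g list \<Rightarrow>\<^sub>0 'f::field"
  shows "Poly_Mapping.single [] c * f = f * Poly_Mapping.single [] c"
proof (rule lin_eq_on_words[where A = "\<lambda>f. Poly_Mapping.single [] c * f"
      and B = "\<lambda>f. f * Poly_Mapping.single [] c"])
  show "lin (\<lambda>f :: 'g list \<Rightarrow>\<^sub>0 'f. Poly_Mapping.single [] c * f)"
    by (simp add: lin_id lin_scal_fun flip: scal_conv_mult)
qed (simp_all add: lin_mult_right lin_id mult_single plus_list_def)

lemma scal_mult_right: "f * scal c g = scal c (f * g)"
proof -
  have "f * scal c g = (f * Poly_Mapping.single [] c) * g"
    by (simp only: scal_conv_mult mult.assoc)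
  also have "\<dots> = (Poly_Mapping.single [] c * f) * g"
    by (simp only: scal_central)
  also have "\<dots> = scal c (f * g)"
    by (simp only: scal_conv_mult mult.assoc)
  finally show ?thesis .
qed

lemma lin_mult_left: "lin A \<Longrightarrow> lin (\<lambda>f. g * A f)"
  by (rule linI) (simp_all add: lin_add lin_scal distrib_left scal_mult_right)

section \<open>Weights\<close>

definition wt :: "letter list \<Rightarrow> int" where
  "wt w = (\<Sum>a\<leftarrow>w. bar a)"

lemma wt_simps [simp]: "wt [] = 0" "wt (a # w) = bar a + wt w" "wt (u @ v) = wt u + wt v"
  by (simp_all add: wt_def)

lemma pairing_conv_bar: "pairing a b = 2 * bar a * bar b"
  by (cases a; cases b) (auto simp: pairing_def)

text \<open>
  The exponents of \<open>q\<close> in the \<open>q\<close>-shuffle product depend on a word only through its weight.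
\<close>

lemma sum_pairing: "(\<Sum>c\<leftarrow>u. pairing c b) = 2 * wt u * bar b"
  by (induction u) (auto simp: pairing_conv_bar algebra_simps)

definition homog :: "int \<Rightarrow> (letter list \<Rightarrow>\<^sub>0 'f::field) \<Rightarrow> bool" where
  "homog n f \<longleftrightarrow> (\<forall>u\<in>Poly_Mapping.keys f. wt u = n)"

lemma homog_word [simp]: "homog n (word u) \<longleftrightarrow> wt u = n"
  by (simp add: homog_def)

lemma homog_one: "homog 0 1"
  using homog_word[of 0 "[]"] by (simp add: word_Nil)

lemma homog_zero [simp]: "homog n 0"
  by (simp add: homog_def)

lemma homog_add: "homog n f \<Longrightarrow> homog n g \<Longrightarrow> homog n (f + g)"
  using keys_add[of f g] by (auto simp: homog_def)

lemma homog_scal: "homog n f \<Longrightarrow> homog n (scal c f)"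
  by (auto simp: homog_def in_keys_iff)

lemma homog_sum: "(\<And>i. i \<in> I \<Longrightarrow> homog n (f i)) \<Longrightarrow> homog n (\<Sum>i\<in>I. f i)"
  by (induction I rule: infinite_finite_induct) (auto intro: homog_add)

lemma homog_lin:
  assumes "lin A" "homog m f" "\<And>u. wt u = m \<Longrightarrow> homog n (A (word u))"
  shows "homog n (A f)"
  unfolding lin_expansion[OF assms(1), of f]
  by (intro homog_sum homog_scal assms(3)) (use assms(2) in \<open>auto simp: homog_def\<close>)

lemma lin_eq_on_homog:
  assumes "lin A" "lin B" "homog n f" "\<And>u. wt u = n \<Longrightarrow> A (word u) = B (word u)"
  shows "A f = B f"
  by (rule lin_eq_on_words[OF assms(1,2)]) (use assms(3,4) in \<open>auto simp: homog_def\<close>)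

lemma homog_letter_mult: "homog n f \<Longrightarrow> homog (bar a + n) (word [a] * f)"
  by (rule homog_lin[where A = "\<lambda>f. word [a] * f" and m = n]) (simp_all add: lin_mult_left lin_id)

lemma homog_mult_letter: "homog n f \<Longrightarrow> homog (n + bar a) (f * word [a])"
  by (rule homog_lin[where A = "\<lambda>f. f * word [a]" and m = n]) (simp_all add: lin_mult_right lin_id)

section \<open>The q-shuffle product\<close>

lemma q_shuffle_conv_linear_extension:
  "q_shuffle q f g = linear_extension (\<lambda>u. linear_extension (shuffle_words q u) g) f"
  by (simp add: q_shuffle_def linear_extension_def scal_sum)

lemma lin_shuffle_left: "lin A \<Longrightarrow> lin (\<lambda>f. q_shuffle q (A f) g)"
  unfolding q_shuffle_conv_linear_extension by (rule lin_comp[OF lin_linear_extension])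

lemma lin_shuffle_right: "lin A \<Longrightarrow> lin (\<lambda>g. q_shuffle q f (A g))"
  unfolding q_shuffle_conv_linear_extension linear_extension_def[of _ f]
  by (rule linI)
    (simp_all add: lin_add lin_scal lin_linear_extension scal_add_right sum.distrib scal_sum
       mult.commute)

lemmas lin_intros = lin_id lin_add_fun lin_scal_fun lin_mult_left lin_mult_right
  lin_shuffle_left lin_shuffle_right

lemma shuffle_word_word [simp]: "q_shuffle q (word u) (word v) = shuffle_words q u v"
  by (simp add: q_shuffle_conv_linear_extension)

lemmas shuffle_linear =
  lin_add[OF lin_shuffle_left[OF lin_id]] lin_add[OF lin_shuffle_right[OF lin_id]]
  lin_diff[OF lin_shuffle_left[OF lin_id]] lin_diff[OF lin_shuffle_right[OF lin_id]]
  lin_scal[OF lin_shuffle_left[OF lin_id]] lin_scal[OF lin_shuffle_right[OF lin_id]]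
  lin_zero[OF lin_shuffle_left[OF lin_id]] lin_zero[OF lin_shuffle_right[OF lin_id]]

lemma shuffle_words_Nil_right [simp]: "shuffle_words q u [] = word u"
  by (cases u) auto

lemma shuffle_one_left: "q_shuffle q 1 f = f"
  by (rule lin_eq_on_words[where A = "\<lambda>f. q_shuffle q 1 f"])
     (auto intro!: lin_intros simp flip: word_Nil)

lemma shuffle_one_right: "q_shuffle q f 1 = f"
  by (rule lin_eq_on_words[where A = "\<lambda>f. q_shuffle q f 1"])
     (auto intro!: lin_intros simp flip: word_Nil)

lemma homog_shuffle_words: "homog (wt u + wt v) (shuffle_words q u v)"
proof (induction q u v rule: shuffle_words.induct)
  case (3 q a u b v)
  show ?case
    using homog_letter_mult[OF 3(1), of a] homog_letter_mult[OF 3(2), of b]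
    by (auto intro!: homog_add homog_scal simp: algebra_simps)
qed auto

lemma homog_shuffle:
  assumes "homog m f" "homog n g"
  shows "homog (m + n) (q_shuffle q f g)"
proof (rule homog_lin[where A = "\<lambda>f. q_shuffle q f g", OF _ assms(1)])
  fix u assume "wt u = m"
  then show "homog (m + n) (q_shuffle q (word u) g)"
    by (intro homog_lin[where A = "\<lambda>g. q_shuffle q (word u) g", OF _ assms(2)])
       (auto intro!: lin_intros simp: homog_shuffle_words)
qed (auto intro!: lin_intros)

text \<open>
  The left factor has to be homogeneous, since the power of \<open>q\<close> is determined by the weight of all
  of its letters.
\<close>

lemma shuffle_Cons_Cons:
  assumes "homog n f"
  shows "q_shuffle q (word [a] * f) (word [b] * g) = word [a] * q_shuffle q f (word [b] * g)
    + scal (q powi (2 * (bar a + n) * bar b)) (word [b] * q_shuffle q (word [a] * f) g)"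
    (is "?L f g = ?R f g")
proof (rule lin_eq_on_homog[where A = "\<lambda>f. ?L f g" and B = "\<lambda>f. ?R f g", OF _ _ assms])
  fix u assume u: "wt u = n"
  have exponent: "pairing a b + (\<Sum>c\<leftarrow>u. pairing c b) = 2 * (bar a + n) * bar b"
    using sum_pairing[of b "a # u"] by (simp add: u)
  show "?L (word u) g = ?R (word u) g"
    by (rule lin_eq_on_words[where A = "\<lambda>g. ?L (word u) g" and B = "\<lambda>g. ?R (word u) g"])
      (auto intro!: lin_intros simp: exponent)
qed (auto intro!: lin_intros)

lemma letter_shuffle_Cons:
  "q_shuffle q (word [a]) (word [b] * g) = word [a] * (word [b] * g)
    + scal (q powi (2 * bar a * bar b)) (word [b] * q_shuffle q (word [a]) g)"
  using shuffle_Cons_Cons[of 0 1 q a b g] by (simp add: shuffle_one_left homog_one)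

lemma Cons_shuffle_letter:
  assumes "homog n f"
  shows "q_shuffle q (word [a] * f) (word [b]) = word [a] * q_shuffle q f (word [b])
    + scal (q powi (2 * (bar a + n) * bar b)) (word [b] * (word [a] * f))"
  using shuffle_Cons_Cons[OF assms, of q a b 1] by (simp add: shuffle_one_right)

text \<open>
  Both ways of bracketing \<open>(a u) \<star> (b v) \<star> (c w)\<close> expand into the same three terms, according to the
  first letter of the result; the powers of \<open>q\<close> agree because weights add up in a product.
\<close>

lemma shuffle_assoc_step:
  fixes q :: "'f::field" and a b c :: letter and u v w :: "letter list \<Rightarrow>\<^sub>0 'f"
  defines "U \<equiv> word [a] * u" and "V \<equiv> word [b] * v" and "W \<equiv> word [c] * w"
  assumes "q \<noteq> 0" and u: "homog m u" and v: "homog n v"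
    and IH: "q_shuffle q (q_shuffle q u V) W = q_shuffle q u (q_shuffle q V W)"
      "q_shuffle q (q_shuffle q U v) W = q_shuffle q U (q_shuffle q v W)"
      "q_shuffle q (q_shuffle q U V) w = q_shuffle q U (q_shuffle q V w)"
  shows "q_shuffle q (q_shuffle q U V) W = q_shuffle q U (q_shuffle q V W)"
proof -
  let ?S = "q_shuffle q"
  have U: "homog (bar a + m) U" and V: "homog (bar b + n) V"
    unfolding U_def V_def by (intro homog_letter_mult u v)+
  define r s t where "r = q powi (2 * (bar a + m) * bar b)" and "s = q powi (2 * (bar b + n) * bar c)"
    and "t = q powi (2 * (bar a + m) * bar c)"
  have ts: "q powi (2 * (bar a + (m + (bar b + n))) * bar c) = t * s"
    "q powi (2 * (bar b + (bar a + m + n)) * bar c) = t * s"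
    using \<open>q \<noteq> 0\<close> by (simp_all add: t_def s_def algebra_simps flip: power_int_add)
  have UV: "?S U V = word [a] * ?S u V + scal r (word [b] * ?S U v)"
    unfolding U_def V_def r_def by (rule shuffle_Cons_Cons[OF u])
  have VW: "?S V W = word [b] * ?S v W + scal s (word [c] * ?S V w)"
    unfolding V_def W_def s_def by (rule shuffle_Cons_Cons[OF v])
  have L1: "?S (word [a] * ?S u V) W
      = word [a] * ?S u (?S V W) + scal (t * s) (word [c] * ?S (word [a] * ?S u V) w)"
    using shuffle_Cons_Cons[OF homog_shuffle[OF u V, of q], of q a c w]
    unfolding W_def[symmetric] ts IH(1) .
  have L2: "?S (word [b] * ?S U v) W
      = word [b] * ?S U (?S v W) + scal (t * s) (word [c] * ?S (word [b] * ?S U v) w)"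
    using shuffle_Cons_Cons[OF homog_shuffle[OF U v, of q], of q b c w]
    unfolding W_def[symmetric] ts IH(2) .
  have R1: "?S U (word [b] * ?S v W) = word [a] * ?S u (word [b] * ?S v W)
      + scal r (word [b] * ?S U (?S v W))"
    unfolding U_def r_def by (rule shuffle_Cons_Cons[OF u])
  have R2: "?S U (word [c] * ?S V w) = word [a] * ?S u (word [c] * ?S V w)
      + scal t (word [c] * ?S U (?S V w))"
    unfolding U_def t_def by (rule shuffle_Cons_Cons[OF u])
  have "?S (?S U V) W = word [a] * ?S u (?S V W) + scal r (word [b] * ?S U (?S v W))
      + scal (t * s) (word [c] * ?S (?S U V) w)"
    unfolding UV
    by (simp add: shuffle_linear L1 L2 scal_add_right distrib_left scal_mult_right mult_ac add_ac)
  also have "\<dots> = ?S U (?S V W)"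
    unfolding IH(3) unfolding VW
    by (simp add: shuffle_linear R1 R2 scal_add_right distrib_left scal_mult_right mult_ac add_ac)
  finally show ?thesis .
qed

lemma shuffle_assoc_words:
  assumes "q \<noteq> 0"
  shows "q_shuffle q (q_shuffle q (word u) (word v)) (word w)
    = q_shuffle q (word u) (q_shuffle q (word v) (word w))"
proof (induction "length u + length v + length w" arbitrary: u v w rule: less_induct)
  case less
  show ?case
  proof (cases "u = [] \<or> v = [] \<or> w = []")
    case True
    then show ?thesis
      by (auto simp: word_Nil shuffle_one_left shuffle_one_right simp del: shuffle_word_word)
  next
    case False
    then obtain a u' b v' c w' where eq: "u = a # u'" "v = b # v'" "w = c # w'"
      by (meson neq_Nil_conv)
    have "q_shuffle q (q_shuffle q (word u') (word v)) (word w)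
        = q_shuffle q (word u') (q_shuffle q (word v) (word w))"
      "q_shuffle q (q_shuffle q (word u) (word v')) (word w)
        = q_shuffle q (word u) (q_shuffle q (word v') (word w))"
      "q_shuffle q (q_shuffle q (word u) (word v)) (word w')
        = q_shuffle q (word u) (q_shuffle q (word v) (word w'))"
      by (intro less; simp add: eq)+
    then show ?thesis
      unfolding eq word_Cons[of a u'] word_Cons[of b v'] word_Cons[of c w']
      by (intro shuffle_assoc_step[where m = "wt u'" and n = "wt v'"]) (use assms in auto)
  qed
qed

lemma shuffle_assoc:
  assumes "q \<noteq> 0"
  shows "q_shuffle q (q_shuffle q f g) h = q_shuffle q f (q_shuffle q g h)" (is "?L f g h = ?R f g h")
proof (rule lin_eq_on_words[where A = "\<lambda>f. ?L f g h" and B = "\<lambda>f. ?R f g h"])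
  fix u show "?L (word u) g h = ?R (word u) g h"
  proof (rule lin_eq_on_words[where A = "\<lambda>g. ?L (word u) g h" and B = "\<lambda>g. ?R (word u) g h"])
    fix v show "?L (word u) (word v) h = ?R (word u) (word v) h"
      by (rule lin_eq_on_words[where A = "\<lambda>h. ?L (word u) (word v) h"
            and B = "\<lambda>h. ?R (word u) (word v) h"])
        (auto intro!: lin_intros shuffle_assoc_words[OF assms] simp del: shuffle_word_word)
  qed (auto intro!: lin_intros)
qed (auto intro!: lin_intros)

text \<open>
  The product reads words from the left by definition; that it has the mirrored recursion takes an
  induction. The elements \<open>C\<^sub>ny\<close> are accessible at their last letter only.
\<close>

lemma shuffle_words_snoc_snoc:
  assumes "q \<noteq> 0"
  shows "shuffle_words q (u @ [b]) (v @ [c]) = shuffle_words q (u @ [b]) v * word [c]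
    + scal (q powi (2 * bar b * (wt v + bar c))) (shuffle_words q u (v @ [c]) * word [b])"
proof (induction "length u + length v" arbitrary: u v rule: less_induct)
  case less
  have sum_bar: "(\<Sum>d\<leftarrow>w. 2 * bar d * bar e) = 2 * wt w * bar e" for w e
    using sum_pairing[of e w] by (simp add: pairing_conv_bar)
  note expand = pairing_conv_bar sum_bar distrib_left distrib_right scal_add_right scal_mult_left
    scal_mult_right mult.assoc power_int_add[OF disjI1, OF assms]
  show ?case
  proof (cases u; cases v)
    assume "u = []" "v = []"
    then show ?thesis by (simp add: expand)
  next
    fix d v' assume "u = []" "v = d # v'"
    then show ?thesis
      using less[of "[]" v'] by (simp add: expand mult_ac add_ac)
  next
    fix a u' assume "u = a # u'" "v = []"
    then show ?thesis
      using less[of u' "[]"] by (simp add: expand mult_ac add_ac)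
  next
    fix a u' d v' assume "u = a # u'" "v = d # v'"
    then show ?thesis
      using less[of u' v] less[of u v'] by (simp add: expand mult_ac add_ac)
  qed
qed

lemma shuffle_snoc_snoc:
  assumes "q \<noteq> 0" "homog n g"
  shows "q_shuffle q (f * word [b]) (g * word [c]) = q_shuffle q (f * word [b]) g * word [c]
    + scal (q powi (2 * bar b * (n + bar c))) (q_shuffle q f (g * word [c]) * word [b])"
    (is "?L f g = ?R f g")
proof (rule lin_eq_on_words[where A = "\<lambda>f. ?L f g" and B = "\<lambda>f. ?R f g"])
  fix u show "?L (word u) g = ?R (word u) g"
  proof (rule lin_eq_on_homog[where A = "\<lambda>g. ?L (word u) g" and B = "\<lambda>g. ?R (word u) g", OF _ _ assms(2)])
    fix v assume "wt v = n"
    then show "?L (word u) (word v) = ?R (word u) (word v)"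
      using shuffle_words_snoc_snoc[OF assms(1), of u b v c] by simp
  qed (auto intro!: lin_intros)
qed (auto intro!: lin_intros)

section \<open>Weighted lattice paths\<close>

text \<open>
  Identities between elements are checked at each word, where they become identities between
  scalars and can be left to commutative ring normalisation. Concatenation is distributed over
  sums at its own type only, which leaves the scalars unexpanded.
\<close>

lemmas word_distribs =
  distrib_left[where 'a = "letter list \<Rightarrow>\<^sub>0 'f::field"] distrib_right[where 'a = "letter list \<Rightarrow>\<^sub>0 'f::field"]
  right_diff_distrib[where 'a = "letter list \<Rightarrow>\<^sub>0 'f::field"] left_diff_distrib[where 'a = "letter list \<Rightarrow>\<^sub>0 'f::field"]

lemmas lookup_simps = lookup_add lookup_minus lookup_scal scal_mult_left scal_mult_right
  word_distribs shuffle_linear scal_add_right scal_diff_right scal_scal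

text \<open>
  The sum of all paths of length \<open>m\<close> from height \<open>s\<close> to height \<open>0\<close>, a path being weighted by the
  product of \<open>qint q (1 + h)\<close> over the \<open>m + 1\<close> heights \<open>h\<close> that it visits. For \<open>m = 0\<close> the only
  factor is \<open>qint q 1 = 1\<close>.
\<close>

primrec catalan_path :: "'f::field \<Rightarrow> nat \<Rightarrow> int \<Rightarrow> (letter list \<Rightarrow>\<^sub>0 'f)" where
  "catalan_path q 0 s = (if s = 0 then 1 else 0)"
| "catalan_path q (Suc m) s = scal (qint q (s + 1))
     (word [LetX] * catalan_path q m (s + 1) + word [LetY] * catalan_path q m (s - 1))"

lemma homog_catalan_path: "homog (- s) (catalan_path q m s)"
proof (induction m arbitrary: s)
  case 0
  then show ?case by (simp add: homog_one)
next
  case (Suc m)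
  show ?case
    using homog_letter_mult[OF Suc[of "s + 1"], of LetX] homog_letter_mult[OF Suc[of "s - 1"], of LetY]
    by (auto intro!: homog_scal homog_add)
qed

locale nondegenerate_q =
  fixes q :: "'f::field"
  assumes q_nonzero: "q \<noteq> 0" and q_square: "q ^ 2 \<noteq> 1"
begin

abbreviation q_shuffle_op (infixl "\<star>" 70) where "f \<star> g \<equiv> q_shuffle q f g"
abbreviation X :: "letter list \<Rightarrow>\<^sub>0 'f" where "X \<equiv> word [LetX]"
abbreviation Y :: "letter list \<Rightarrow>\<^sub>0 'f" where "Y \<equiv> word [LetY]"
abbreviation \<kappa> :: 'f where "\<kappa> \<equiv> q - inverse q"

lemma kappa_nonzero: "\<kappa> \<noteq> 0"
  using q_nonzero q_square by (auto simp: power2_eq_square field_simps)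

lemma kappa_qint: "\<kappa> * qint q n = q powi n - q powi (- n)"
  using kappa_nonzero by (simp add: qint_def)

lemma qint_simps [simp]: "qint q 0 = 0" "qint q 1 = 1"
  using kappa_nonzero by (auto simp: qint_def power_int_minus)

lemma catalan_path_minus_one [simp]: "catalan_path q m (-1) = 0"
  by (cases m) auto

lemma powi_shift:
  "q powi (s + 1) = q * q powi s" "q powi (- s - 1) = inverse q * q powi (- s)"
  "q powi (s - 1) = inverse q * q powi s" "q powi (1 - s) = q * q powi (- s)"
  using q_nonzero
  by (auto simp: power_int_add power_int_diff power_int_minus field_simps)

lemma qint_two: "qint q 2 = q + inverse q"
proof -
  have "\<kappa> * qint q 2 = \<kappa> * (q + inverse q)"
    unfolding kappa_qint using q_nonzero
    by (simp add: power_int_minus field_simps power2_eq_square)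
  then show ?thesis
    using kappa_nonzero by simp
qed

lemma qint_succ: "qint q (s + 1) = q * qint q s + q powi (- s)"
proof -
  have "\<kappa> * qint q (s + 1) = q * (\<kappa> * qint q s) + \<kappa> * q powi (- s)"
    unfolding kappa_qint using q_nonzero
    by (simp add: power_int_add power_int_diff power_int_minus field_simps)
  also have "\<dots> = \<kappa> * (q * qint q s + q powi (- s))"
    by (simp add: algebra_simps)
  finally show ?thesis
    using kappa_nonzero by simp
qed

text \<open>
  The numerical identity behind the telescoping below: with \<open>[n]\<close> for \<open>qint q n\<close> it is
  \<open>[s+1] [s+2] - [s] [s+1] = [2s+2]\<close>, multiplied by \<open>\<kappa>\<close>.
\<close>

lemma qint_telescope:
  "\<kappa> * qint q (s + 1) * qint q (s + 2)
     = \<kappa> * qint q s * qint q (s + 1) + ((q * q powi s)\<^sup>2 - (inverse q * q powi (- s))\<^sup>2)"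
proof -
  define c0 c1 c2 p r where "c0 = qint q s" and "c1 = qint q (s + 1)" and "c2 = qint q (s + 2)"
    and "p = q powi s" and "r = q powi (- s)"
  have "\<kappa> * c2 = \<kappa> * (c0 + q * p + inverse q * r)"
    unfolding distrib_left c2_def c0_def kappa_qint p_def r_def using q_nonzero
    by (simp add: power_int_add power_int_diff power_int_minus field_simps power2_eq_square)
  then have c2: "c2 = c0 + q * p + inverse q * r"
    using kappa_nonzero by simp
  have c1: "\<kappa> * c1 = q * p - inverse q * r"
    unfolding c1_def kappa_qint p_def r_def by (simp add: powi_shift)
  have "\<kappa> * c1 * c2 = c0 * (\<kappa> * c1) + (\<kappa> * c1) * (q * p + inverse q * r)"
    by (simp add: c2 algebra_simps)
  also have "\<dots> = \<kappa> * c0 * c1 + (q * p - inverse q * r) * (q * p + inverse q * r)"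
    unfolding c1 unfolding c1[symmetric] by (simp add: mult_ac)
  finally have "\<kappa> * c1 * c2 = \<kappa> * c0 * c1 + ((q * p)\<^sup>2 - (inverse q * r)\<^sup>2)"
    by (simp add: power2_eq_square algebra_simps)
  then show ?thesis
    by (simp only: c0_def c1_def c2_def p_def r_def)
qed

text \<open>
  The product \<open>f \<star> y\<close> inserts \<open>y\<close> at every place of a path from \<open>s\<close> to \<open>0\<close>, with factor \<open>q\<^sup>2\<^sup>h\<close> if the
  height there is \<open>h\<close>, and \<open>y \<star> f\<close> does so with factor \<open>q\<^sup>2\<^sup>s\<^sup>-\<^sup>2\<^sup>h\<close>. The combination below is the one
  that inserts \<open>y\<close> with factor \<open>\<kappa> [2h + 2]\<close>, so that the coefficient of a given result is a
  telescoping sum over its down steps. The start moves up by one because \<open>y\<close> is one more step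
  down.
\<close>

lemma catalan_path_shuffle_Y:
  "scal (q\<^sup>2) (catalan_path q m s \<star> Y) - scal ((inverse q * q powi (- s))\<^sup>2) (Y \<star> catalan_path q m s)
     = scal (\<kappa> * qint q (s + 1)) (catalan_path q (Suc m) (s + 1))"
proof (induction m arbitrary: s)
  case 0
  show ?case
  proof (cases "s = 0")
    case True
    have "q\<^sup>2 - (inverse q)\<^sup>2 = \<kappa> * qint q 2"
      by (simp add: kappa_qint power_int_minus power_inverse)
    then show ?thesis
      using True
      by (simp add: shuffle_one_left shuffle_one_right flip: scal_sub_left)
  next
    case False
    then show ?thesis by (cases "s = -2") (auto simp: shuffle_linear)
  qed
next
  case (Suc m)
  define A B where "A = catalan_path q m (s + 1)" and "B = catalan_path q m (s - 1)"
  define p r where "p = q powi s" and "r = q powi (- s)"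
  have hA: "homog (- s - 1) A" and hB: "homog (1 - s) B"
    using homog_catalan_path[of "s + 1" q m] homog_catalan_path[of "s - 1" q m] by (simp_all add: A_def B_def)
  have pp: "q powi (2 * s) = p\<^sup>2"
    using q_nonzero by (simp add: p_def power_int_mult mult.commute)
  have right: "(X * A) \<star> Y = X * (A \<star> Y) + scal (p\<^sup>2) (Y * (X * A))"
      "(Y * B) \<star> Y = Y * (B \<star> Y) + scal (p\<^sup>2) (Y * (Y * B))"
    using Cons_shuffle_letter[OF hA, of q LetX LetY] Cons_shuffle_letter[OF hB, of q LetY LetY]
    by (simp_all add: pp)
  have left: "Y \<star> (X * A) = Y * (X * A) + scal ((inverse q)\<^sup>2) (X * (Y \<star> A))"
    "Y \<star> (Y * B) = Y * (Y * B) + scal (q\<^sup>2) (Y * (Y \<star> B))"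
    by (simp_all add: letter_shuffle_Cons power_int_minus power_inverse)
  define c0 c1 c2 where "c0 = qint q s" and "c1 = qint q (s + 1)" and "c2 = qint q (s + 2)"
  have IH_A: "scal (q\<^sup>2) (A \<star> Y) - scal ((inverse q * r)\<^sup>2 * (inverse q)\<^sup>2) (Y \<star> A)
      = scal (\<kappa> * c2) (catalan_path q (Suc m) (s + 2))"
    using Suc[of "s + 1"] by (simp add: A_def r_def c2_def powi_shift power_mult_distrib mult_ac add.commute[of s 2] del: catalan_path.simps)
  have IH_B: "scal (q\<^sup>2) (B \<star> Y) - scal ((inverse q * r)\<^sup>2 * q\<^sup>2) (Y \<star> B) = scal (\<kappa> * c0) (catalan_path q (Suc m) s)"
    using Suc[of "s - 1"] q_nonzero by (simp add: B_def r_def c0_def powi_shift power_mult_distrib mult_ac del: catalan_path.simps)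
  have G0: "catalan_path q (Suc m) s = scal c1 (X * A + Y * B)"
    and G1: "catalan_path q (Suc (Suc m)) (s + 1)
      = scal c2 (X * catalan_path q (Suc m) (s + 2) + Y * catalan_path q (Suc m) s)"
    by (simp_all add: A_def B_def c1_def c2_def add.commute[of s 2])
  have scalar: "\<kappa> * c1 * c2 = \<kappa> * c0 * c1 + ((q * p)\<^sup>2 - (inverse q * r)\<^sup>2)"
    unfolding c0_def c1_def c2_def p_def r_def by (rule qint_telescope)
  have "scal (q\<^sup>2) (catalan_path q (Suc m) s \<star> Y)
      - scal ((inverse q * r)\<^sup>2) (Y \<star> catalan_path q (Suc m) s)
    = scal c1 (X * (scal (q\<^sup>2) (A \<star> Y) - scal ((inverse q * r)\<^sup>2 * (inverse q)\<^sup>2) (Y \<star> A))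
        + Y * (scal (q\<^sup>2) (B \<star> Y) - scal ((inverse q * r)\<^sup>2 * q\<^sup>2) (Y \<star> B)))
      + scal ((q * p)\<^sup>2 - (inverse q * r)\<^sup>2) (Y * catalan_path q (Suc m) s)"
    unfolding G0
    by (rule poly_mapping_eqI) (simp add: lookup_simps right left power_mult_distrib[of q p] algebra_simps)
  also have "\<dots> = scal (\<kappa> * c1 * c2) (X * catalan_path q (Suc m) (s + 2))
      + scal (\<kappa> * c0 * c1 + ((q * p)\<^sup>2 - (inverse q * r)\<^sup>2)) (Y * catalan_path q (Suc m) s)"
    unfolding IH_A IH_B
    by (rule poly_mapping_eqI) (simp add: lookup_simps algebra_simps del: catalan_path.simps)
  also have "\<dots> = scal (\<kappa> * c1) (catalan_path q (Suc (Suc m)) (s + 1))"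
    unfolding scalar[symmetric] G1
    by (rule poly_mapping_eqI) (simp add: lookup_simps algebra_simps del: catalan_path.simps)
  finally show ?case
    by (simp only: c1_def r_def)
qed

text \<open>
  This combination inserts \<open>x\<close> at height \<open>h\<close> with factor \<open>\<kappa> [2h + 2]\<close>. The appended \<open>y\<close> takes the
  path down to height \<open>-1\<close>, where the factor vanishes, so nothing is inserted after it. The
  telescoping sum leaves its upper end, a path weight again, and its lower end, which carries
  \<open>[s] [s + 1]\<close> and thus disappears for \<open>s = 0\<close>.
\<close>

lemma letter_X_shuffle_catalan_path:
  "scal ((q * q powi s)\<^sup>2) (X \<star> (catalan_path q m s * Y)) - (catalan_path q m s * Y) \<star> X
     = scal \<kappa> (catalan_path q (Suc (Suc m)) s - scal (qint q s * qint q (s + 1))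
         (X * (catalan_path q m s * Y) + Y * (catalan_path q m (s - 2) * Y)))"
proof (induction m arbitrary: s)
  case 0
  consider "s = 0" | "s = 2" | "s \<noteq> 0" "s \<noteq> 2" by blast
  then show ?case
  proof cases
    case 1
    have "\<kappa> * qint q 2 = q\<^sup>2 - (inverse q)\<^sup>2"
      by (simp add: kappa_qint power_int_minus power_inverse)
    then have "scal (q\<^sup>2) w - scal ((inverse q)\<^sup>2) w = scal (\<kappa> * qint q 2) w" for w :: "letter list \<Rightarrow>\<^sub>0 'f"
      by (simp add: scal_sub_left)
    moreover have "X \<star> Y = word [LetX, LetY] + scal ((inverse q)\<^sup>2) (word [LetY, LetX])"
      "Y \<star> X = word [LetY, LetX] + scal ((inverse q)\<^sup>2) (word [LetX, LetY])"
      by (simp_all add: pairing_def power_int_minus power_inverse)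
    ultimately show ?thesis
      using 1 q_nonzero
      by (simp add: scal_add_right scal_mult_right flip: power_mult_distrib)
  next
    case 2
    then show ?thesis
      by (simp add: shuffle_linear scal_mult_right scal_add_right mult.commute)
  next
    case 3
    then show ?thesis
      by (cases "s = -2") (auto simp: shuffle_linear scal_mult_right)
  qed
next
  case (Suc m)
  define A B D where "A = catalan_path q m (s + 1) * Y" and "B = catalan_path q m (s - 1) * Y"
    and "D = catalan_path q m (s - 3) * Y"
  define p r where "p = q powi s" and "r = q powi (- s)"
  define c c0 c1 c2 where "c = qint q (s - 1)" and "c0 = qint q s" and "c1 = qint q (s + 1)"
    and "c2 = qint q (s + 2)"
  have hA: "homog (- 2 - s) A" and hB: "homog (- s) B"
    using homog_mult_letter[OF homog_catalan_path[of "s + 1" q m], of LetY]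
      homog_mult_letter[OF homog_catalan_path[of "s - 1" q m], of LetY]
    by (simp_all add: A_def B_def)
  have "2 * (- 1 - s) = (- s - 1) * 2"
    by simp
  then have rr: "q powi (2 * (- 1 - s)) = (inverse q * r)\<^sup>2"
    by (simp only: power_int_mult r_def powi_shift) simp
  have right: "(X * A) \<star> X = X * (A \<star> X) + scal ((inverse q * r)\<^sup>2) (X * (X * A))"
      "(Y * B) \<star> X = Y * (B \<star> X) + scal ((inverse q * r)\<^sup>2) (X * (Y * B))"
    using Cons_shuffle_letter[OF hA, of q LetX LetX] Cons_shuffle_letter[OF hB, of q LetY LetX]
    by (simp_all add: rr[symmetric])
  have left: "X \<star> (X * A) = X * (X * A) + scal (q\<^sup>2) (X * (X \<star> A))"
    "X \<star> (Y * B) = X * (Y * B) + scal ((inverse q)\<^sup>2) (Y * (X \<star> B))"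
    by (simp_all add: letter_shuffle_Cons power_int_minus power_inverse)
  have IH_A: "scal ((q * p)\<^sup>2 * q\<^sup>2) (X \<star> A) - A \<star> X
      = scal \<kappa> (catalan_path q (Suc (Suc m)) (s + 1) - scal (c1 * c2) (X * A + Y * B))"
    using Suc[of "s + 1"]
    by (simp add: A_def B_def p_def c1_def c2_def powi_shift power_mult_distrib mult_ac
        add.commute[of s 2] del: catalan_path.simps)
  have IH_B: "scal ((q * p)\<^sup>2 * (inverse q)\<^sup>2) (X \<star> B) - B \<star> X
      = scal \<kappa> (catalan_path q (Suc (Suc m)) (s - 1) - scal (c * c0) (X * B + Y * D))"
    using Suc[of "s - 1"] q_nonzero
    by (simp add: B_def D_def p_def c_def c0_def powi_shift power_mult_distrib mult_ac
        del: catalan_path.simps)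
  have G0: "catalan_path q (Suc m) s * Y = scal c1 (X * A + Y * B)"
    and G1: "catalan_path q (Suc m) (s - 2) * Y = scal c (X * B + Y * D)"
    and G2: "catalan_path q (Suc (Suc (Suc m))) s
      = scal c1 (X * catalan_path q (Suc (Suc m)) (s + 1) + Y * catalan_path q (Suc (Suc m)) (s - 1))"
    by (simp_all add: A_def B_def D_def c_def c1_def scal_mult_left distrib_right mult.assoc)
  have scalar: "\<kappa> * c1 * c2 = \<kappa> * c0 * c1 + ((q * p)\<^sup>2 - (inverse q * r)\<^sup>2)"
    unfolding c0_def c1_def c2_def p_def r_def by (rule qint_telescope)
  have "scal ((q * p)\<^sup>2) (X \<star> (catalan_path q (Suc m) s * Y)) - (catalan_path q (Suc m) s * Y) \<star> X
    = scal c1 (X * (scal ((q * p)\<^sup>2 * q\<^sup>2) (X \<star> A) - A \<star> X)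
        + Y * (scal ((q * p)\<^sup>2 * (inverse q)\<^sup>2) (X \<star> B) - B \<star> X))
      + scal ((q * p)\<^sup>2 - (inverse q * r)\<^sup>2) (X * (catalan_path q (Suc m) s * Y))"
    unfolding G0
    by (rule poly_mapping_eqI) (simp add: lookup_simps right left algebra_simps)
  also have "\<dots> = scal (\<kappa> * c1) (X * catalan_path q (Suc (Suc m)) (s + 1)
        + Y * catalan_path q (Suc (Suc m)) (s - 1))
      + scal ((q * p)\<^sup>2 - (inverse q * r)\<^sup>2 - \<kappa> * c1 * c2) (X * (catalan_path q (Suc m) s * Y))
      - scal (\<kappa> * c0 * c1) (Y * (catalan_path q (Suc m) (s - 2) * Y))"
    unfolding IH_A IH_B G0 G1
    by (rule poly_mapping_eqI) (simp add: lookup_simps algebra_simps del: catalan_path.simps)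
  also have "\<dots> = scal \<kappa> (catalan_path q (Suc (Suc (Suc m))) s - scal (c0 * c1)
         (X * (catalan_path q (Suc m) s * Y) + Y * (catalan_path q (Suc m) (s - 2) * Y)))"
    unfolding scalar G2
    by (rule poly_mapping_eqI) (simp add: lookup_simps algebra_simps del: catalan_path.simps)
  finally show ?case
    by (simp only: c0_def c1_def p_def)
qed

text \<open>
  The commutator inserts \<open>x\<close> at a height \<open>h\<close> and, not before it, \<open>y\<close> at a height \<open>h'\<close> with factor
  \<open>\<kappa> [2h' - 2h]\<close>. That factor does not telescope for one letter at a time, but
  \<open>[2h' - 2h] = q\<^sup>-\<^sup>2\<^sup>h\<^sup>-\<^sup>2 [2h' + 2] - q\<^sup>-\<^sup>2\<^sup>h\<^sup>'\<^sup>-\<^sup>2 [2h + 2]\<close>: the first part sums over the places of \<open>y\<close>,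
  the second over those of \<open>x\<close>. What remains is a sum over the steps of the resulting path, in
  which each step up cancels the step down between the same heights, up to a geometric sum of
  value proportional to \<open>[s]\<close>, and the lower end of the sum over \<open>x\<close>, which is
  the product with \<open>y\<close> on the right-hand side. For \<open>s = 0\<close> both terms vanish.
\<close>

lemma catalan_path_shuffle_XY:
  "catalan_path q m s \<star> (X * Y) - (X * Y) \<star> catalan_path q m s
     = scal \<kappa> (scal ((q powi (- s))\<^sup>2 * qint q (s + 1)) (Y \<star> catalan_path q (Suc m) (s - 1))
         - scal (inverse q * q powi (- s) * qint q s) (catalan_path q (Suc (Suc m)) s))"
proof (induction m arbitrary: s)
  case 0
  consider "s = 0" | "s = 2" | "s \<noteq> 0" "s \<noteq> 2" by blast
  then show ?case
  proof cases
    case 1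
    then show ?thesis
      by (simp add: shuffle_one_left shuffle_one_right shuffle_linear)
  next
    case 2
    have "Y \<star> Y = scal (1 + q\<^sup>2) (word [LetY, LetY])"
      by (simp add: pairing_def scal_add_left)
    moreover have "(inverse q ^ 2)\<^sup>2 * (1 + q\<^sup>2) = inverse q * (inverse q)\<^sup>2 * qint q 2"
      using q_nonzero by (simp add: qint_two field_simps power2_eq_square)
    ultimately show ?thesis
      using 2
      by (simp add: shuffle_linear scal_mult_right power_int_minus power_inverse mult_ac)
  next
    case 3
    then show ?thesis
      by (cases "s = -2") (auto simp: shuffle_linear scal_mult_right)
  qed
next
  case (Suc m)
  define A B G G' where "A = catalan_path q m (s + 1)" and "B = catalan_path q m (s - 1)"
    and "G = catalan_path q (Suc m) s" and "G' = catalan_path q (Suc m) (s - 2)"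
  define H K where "H = catalan_path q (Suc (Suc m)) (s + 1)" and "K = catalan_path q (Suc (Suc m)) (s - 1)"
  define i p r where "i = inverse q" and "p = q powi s" and "r = q powi (- s)"
  define c c0 c1 c2 where "c = qint q (s - 1)" and "c0 = qint q s" and "c1 = qint q (s + 1)"
    and "c2 = qint q (s + 2)"
  have hA: "homog (- s - 1) A" and hB: "homog (1 - s) B"
    using homog_catalan_path[of "s + 1" q m] homog_catalan_path[of "s - 1" q m]
    by (simp_all add: A_def B_def)
  have inv: "q * i = 1" "p * r = 1"
    using q_nonzero by (simp_all add: i_def p_def r_def power_int_minus)
  have c1: "c1 = q * c0 + r"
    unfolding c0_def c1_def r_def by (rule qint_succ)
  have "c0 = q * c + q * r"
    using qint_succ[of "s - 1"] by (simp add: c0_def c_def r_def powi_shift)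
  then have c: "c = i * c0 - r"
    using inv by (simp add: algebra_simps)
  \<comment> \<open>after multiplication with \<open>(i r)\<^sup>2\<close>, the inverse of \<open>(q p)\<^sup>2\<close>, this settles the coefficient of \<open>x (y \<star> G)\<close>\<close>
  have scalar: "\<kappa> * c1 * c2 = \<kappa> * c0 * c1 + ((q * p)\<^sup>2 - (i * r)\<^sup>2)"
    unfolding c0_def c1_def c2_def p_def r_def i_def by (rule qint_telescope)
  have rr: "q powi (- (2 * s)) = r\<^sup>2"
    using q_nonzero by (simp add: r_def mult.commute[of _ s] power_int_mult flip: mult_minus_left)
  have right: "(X * A) \<star> (X * Y) = X * (A \<star> (X * Y)) + scal (r\<^sup>2) (X * ((X * A) \<star> Y))"
      "(Y * B) \<star> (X * Y) = Y * (B \<star> (X * Y)) + scal (r\<^sup>2) (X * ((Y * B) \<star> Y))"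
    using shuffle_Cons_Cons[OF hA, of q LetX LetX Y] shuffle_Cons_Cons[OF hB, of q LetY LetX Y]
    by (simp_all add: rr del: word_mult)
  have left: "(X * Y) \<star> (X * A) = X * (Y \<star> (X * A)) + X * ((X * Y) \<star> A)"
    "(X * Y) \<star> (Y * B) = X * (Y \<star> (Y * B)) + Y * ((X * Y) \<star> B)"
    using shuffle_Cons_Cons[of "-1" Y q LetX LetX A] shuffle_Cons_Cons[of "-1" Y q LetX LetY B]
    by (simp_all del: word_mult)
  have IH_A: "A \<star> (X * Y) - (X * Y) \<star> A
      = scal \<kappa> (scal (i\<^sup>2 * r\<^sup>2 * c2) (Y \<star> G) - scal (i\<^sup>2 * r * c1) H)"
    using Suc[of "s + 1"]
    by (simp add: A_def G_def H_def i_def r_def c1_def c2_def powi_shift power_mult_distrib mult_ac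
        add.commute[of s 2] power2_eq_square del: catalan_path.simps word_mult)
  have cancel: "q * (inverse q * z) = z" for z
    using q_nonzero by simp
  have IH_B: "B \<star> (X * Y) - (X * Y) \<star> B
      = scal \<kappa> (scal (q\<^sup>2 * r\<^sup>2 * c0) (Y \<star> G') - scal (r * c) K)"
    using Suc[of "s - 1"] cancel
    by (simp add: B_def G'_def K_def r_def c_def c0_def powi_shift power_mult_distrib mult_ac
        del: catalan_path.simps word_mult)
  \<comment> \<open>eliminates \<open>G \<star> y\<close> in favour of \<open>y \<star> G\<close>, which is what the claim contains\<close>
  have Z: "scal (q\<^sup>2) (G \<star> Y) - scal ((i * r)\<^sup>2) (Y \<star> G) = scal (\<kappa> * c1) H"
    unfolding G_def i_def r_def c1_def H_def by (rule catalan_path_shuffle_Y)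
  have "scal (i\<^sup>2 * r\<^sup>2 * q\<^sup>2) (G \<star> Y) = scal (i\<^sup>2 * r\<^sup>2) (scal (\<kappa> * c1) H + scal ((i * r)\<^sup>2) (Y \<star> G))"
    unfolding Z[symmetric] by (simp add: mult.assoc)
  moreover have "i\<^sup>2 * r\<^sup>2 * q\<^sup>2 = r\<^sup>2"
    using q_nonzero by (simp add: i_def field_simps)
  ultimately have GY: "scal (r\<^sup>2) (G \<star> Y) = scal (i\<^sup>2 * r\<^sup>2) (scal (\<kappa> * c1) H + scal ((i * r)\<^sup>2) (Y \<star> G))"
    by simp
  have G0: "G = scal c1 (X * A + Y * B)" and K0: "K = scal c0 (X * G + Y * G')"
    and G2: "catalan_path q (Suc (Suc (Suc m))) s = scal c1 (X * H + Y * K)"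
    by (simp_all add: A_def B_def G_def G'_def H_def K_def c0_def c1_def)
  have YK: "Y \<star> K = Y * K + scal c0 (scal (i\<^sup>2) (X * (Y \<star> G)) + scal (q\<^sup>2) (Y * (Y \<star> G')))"
    unfolding K0 using letter_shuffle_Cons[of q LetY LetX G] letter_shuffle_Cons[of q LetY LetY G']
    by (simp add: shuffle_linear scal_add_right scal_mult_right distrib_left i_def power_int_minus
        power_inverse)
  have "G \<star> (X * Y) - (X * Y) \<star> G
    = scal c1 (X * (A \<star> (X * Y) - (X * Y) \<star> A) + Y * (B \<star> (X * Y) - (X * Y) \<star> B))
      + X * (scal (r\<^sup>2) (G \<star> Y) - Y \<star> G)"
    unfolding G0
    by (rule poly_mapping_eqI) (simp add: lookup_simps right left algebra_simps del: word_mult)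
  also have "\<dots> = scal (i\<^sup>2 * r\<^sup>2 * (\<kappa> * c1 * c2) - 1 + i\<^sup>2 * r\<^sup>2 * (i * r)\<^sup>2) (X * (Y \<star> G))
      + scal (\<kappa> * c0 * c1 * r\<^sup>2 * q\<^sup>2) (Y * (Y \<star> G'))
      - scal (\<kappa> * c1 * i\<^sup>2 * r * (c1 - r)) (X * H) - scal (\<kappa> * c1 * r * c) (Y * K)"
    unfolding IH_A IH_B GY
    by (rule poly_mapping_eqI) (simp add: lookup_simps algebra_simps power2_eq_square)
  also have "i\<^sup>2 * r\<^sup>2 * (\<kappa> * c1 * c2) - 1 + i\<^sup>2 * r\<^sup>2 * (i * r)\<^sup>2 = \<kappa> * c0 * c1 * r\<^sup>2 * i\<^sup>2"
  proof -
    have "i\<^sup>2 * r\<^sup>2 * (q * p)\<^sup>2 = ((q * i) * (p * r))\<^sup>2"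
      by (simp add: power2_eq_square mult_ac)
    then have "i\<^sup>2 * r\<^sup>2 * (q * p)\<^sup>2 = 1"
      by (simp add: inv)
    then show ?thesis
      unfolding scalar distrib_left right_diff_distrib by (simp add: mult_ac)
  qed
  also have "\<kappa> * c1 * i\<^sup>2 * r * (c1 - r) = \<kappa> * c0 * c1 * i * r * (q * i)"
    by (simp add: c1 power2_eq_square mult_ac)
  also have "scal (\<kappa> * c0 * c1 * r\<^sup>2 * i\<^sup>2) (X * (Y \<star> G)) + scal (\<kappa> * c0 * c1 * r\<^sup>2 * q\<^sup>2) (Y * (Y \<star> G'))
      - scal (\<kappa> * c0 * c1 * i * r * (q * i)) (X * H) - scal (\<kappa> * c1 * r * c) (Y * K)
    = scal \<kappa> (scal (r\<^sup>2 * c1) (Y \<star> K) - scal (i * r * c0) (catalan_path q (Suc (Suc (Suc m))) s))"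
    unfolding G2 YK inv c
    by (rule poly_mapping_eqI) (simp add: lookup_simps algebra_simps power2_eq_square)
  finally show ?case
    by (simp only: G_def K_def i_def r_def c0_def c1_def)
qed

end

section \<open>Catalan elements\<close>

lemma bar_sum_simps [simp]: "bar_sum 0 w = 0" "bar_sum (Suc i) (a # w) = bar a + bar_sum i w"
  by (simp_all add: bar_sum_def)

lemma bar_sum_length: "bar_sum (length w) w = wt w"
  by (simp add: bar_sum_def wt_def)

definition nonneg_paths :: "nat \<Rightarrow> int \<Rightarrow> letter list set" where
  "nonneg_paths m s = {w. length w = m \<and> s + wt w = 0 \<and> (\<forall>i\<le>m. 0 \<le> s + bar_sum i w)}"

lemma finite_nonneg_paths: "finite (nonneg_paths m s)"
proof (rule finite_subset)
  have UNIV: "a \<in> {LetX, LetY}" for a by (cases a) auto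
  then show "nonneg_paths m s \<subseteq> {w. set w \<subseteq> {LetX, LetY} \<and> length w = m}"
    by (auto simp: nonneg_paths_def)
qed (rule finite_lists_length_eq, simp)

lemma all_le_Suc: "(\<forall>i\<le>Suc m. P i) \<longleftrightarrow> P 0 \<and> (\<forall>i\<le>m. P (Suc i))"
  by (metis Suc_le_mono not0_implies_Suc zero_le)

lemma nonneg_paths_Suc:
  assumes "s \<ge> 0"
  shows "nonneg_paths (Suc m) s
    = (#) LetX ` nonneg_paths m (s + 1) \<union> (#) LetY ` nonneg_paths m (s - 1)"
proof (rule Set.set_eqI)
  fix w
  show "w \<in> nonneg_paths (Suc m) s
    \<longleftrightarrow> w \<in> (#) LetX ` nonneg_paths m (s + 1) \<union> (#) LetY ` nonneg_paths m (s - 1)"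
  proof (cases w)
    case (Cons a w')
    then show ?thesis
      using assms
      by (cases a) (auto simp: nonneg_paths_def all_le_Suc image_iff algebra_simps)
  qed (auto simp: nonneg_paths_def)
qed

lemma nonneg_paths_negative: "s < 0 \<Longrightarrow> nonneg_paths m s = {}"
  by (auto simp: nonneg_paths_def intro!: exI[of _ 0])

context nondegenerate_q
begin

text \<open>
  The induction passes through paths that start at \<open>-1\<close>; there are none that stay nonnegative, and
  \<open>catalan_path\<close> vanishes there because \<open>[0] = 0\<close>. This is why paths that go below \<open>0\<close> need not be
  excluded in the recursion.
\<close>

lemma catalan_path_as_sum:
  assumes "s \<ge> -1"
  shows "catalan_path q m s
    = (\<Sum>w\<in>nonneg_paths m s. scal (\<Prod>i\<le>m. qint q (1 + (s + bar_sum i w))) (word w))"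
  using assms
proof (induction m arbitrary: s)
  case 0
  have "nonneg_paths 0 s = (if s = 0 then {[]} else {})"
    by (auto simp: nonneg_paths_def)
  then show ?case
    by (simp add: word_Nil qint_simps)
next
  case (Suc m)
  show ?case
  proof (cases "s = -1")
    case True
    then show ?thesis
      by (simp add: nonneg_paths_negative qint_simps)
  next
    case False
    then have "s \<ge> 0" using Suc.prems by simp
    have IH: "word [a] * catalan_path q m (s + bar a) = (\<Sum>w\<in>nonneg_paths m (s + bar a).
        scal (\<Prod>i\<le>m. qint q (1 + (s + bar_sum (Suc i) (a # w)))) (word (a # w)))" for a
      using Suc.IH[of "s + bar a"] \<open>s \<ge> 0\<close>
      by (cases a) (simp_all add: sum_distrib_left scal_mult_right add_ac)
    have "(\<Sum>w\<in>nonneg_paths (Suc m) s. scal (\<Prod>i\<le>Suc m. qint q (1 + (s + bar_sum i w))) (word w))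
      = (\<Sum>w\<in>nonneg_paths m (s + 1). scal (\<Prod>i\<le>Suc m. qint q (1 + (s + bar_sum i (LetX # w)))) (word (LetX # w)))
      + (\<Sum>w\<in>nonneg_paths m (s - 1). scal (\<Prod>i\<le>Suc m. qint q (1 + (s + bar_sum i (LetY # w)))) (word (LetY # w)))"
      unfolding nonneg_paths_Suc[OF \<open>s \<ge> 0\<close>]
      by (subst sum.union_disjoint) (auto simp: finite_nonneg_paths sum.reindex)
    also have "\<dots> = scal (qint q (s + 1)) (X * catalan_path q m (s + bar LetX))
      + scal (qint q (s + 1)) (Y * catalan_path q m (s + bar LetY))"
      unfolding IH scal_sum scal_scal prod.atMost_Suc_shift
      by (simp add: add_ac)
    finally show ?thesis
      by (simp add: scal_add_right)
  qed
qed

lemma catalan_elt_conv_path: "catalan_elt q n = catalan_path q (2 * n) 0"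
proof -
  have "{w. length w = 2 * n \<and> catalan_word w} = nonneg_paths (2 * n) 0"
  proof (rule Set.set_eqI)
    fix w :: "letter list"
    have "(\<forall>i\<in>{1..length w}. 0 \<le> bar_sum i w) \<longleftrightarrow> (\<forall>i\<le>length w. 0 \<le> bar_sum i w)"
      by (metis atLeastAtMost_iff bar_sum_simps(1) le_zero_eq less_one linorder_not_less order_refl)
    then show "w \<in> {w. length w = 2 * n \<and> catalan_word w} \<longleftrightarrow> w \<in> nonneg_paths (2 * n) 0"
      by (auto simp: nonneg_paths_def catalan_word_def bar_sum_length)
  qed
  then show ?thesis
    by (simp add: catalan_elt_def catalan_path_as_sum atLeast0AtMost)
qed

lemma catalan_elt_Suc: "catalan_elt q (Suc n) = X * catalan_path q (Suc (2 * n)) 1"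
  using qint_simps catalan_path_minus_one
  by (simp add: catalan_elt_conv_path)

lemma homog_catalan_elt: "homog 0 (catalan_elt q n)"
  using homog_catalan_path[of 0 q "2 * n"] by (simp add: catalan_elt_conv_path)

text \<open>
  At the start \<open>s = 0\<close> the first step of a nonnegative path is \<open>x\<close>, so \<open>x\<close> times the right-hand side
  of \<open>catalan_path_shuffle_Y\<close> is a multiple of a Catalan element. The terms \<open>y x C\<^sub>n\<close>, with \<open>y\<close> in front, cancel.
\<close>

lemma XC_shuffle_Y:
  "(X * catalan_elt q n) \<star> Y - scal ((inverse q)\<^sup>2) (Y \<star> (X * catalan_elt q n))
     = scal ((inverse q)\<^sup>2 * \<kappa>) (catalan_elt q (Suc n))"
proof -
  let ?C = "catalan_elt q n"
  have "scal (q\<^sup>2) (?C \<star> Y) - scal ((inverse q)\<^sup>2) (Y \<star> ?C) = scal \<kappa> (catalan_path q (Suc (2 * n)) 1)"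
    using catalan_path_shuffle_Y[of "2 * n" 0]
    by (simp add: catalan_elt_conv_path qint_simps)
  then have "scal ((inverse q)\<^sup>2) (X * (scal (q\<^sup>2) (?C \<star> Y) - scal ((inverse q)\<^sup>2) (Y \<star> ?C)))
      = scal ((inverse q)\<^sup>2 * \<kappa>) (catalan_elt q (Suc n))"
    by (simp add: catalan_elt_Suc scal_mult_right del: catalan_path.simps)
  moreover have "(X * ?C) \<star> Y = X * (?C \<star> Y) + scal ((inverse q)\<^sup>2) (Y * (X * ?C))"
    using Cons_shuffle_letter[OF homog_catalan_elt[of n], of q LetX LetY]
    by (simp add: power_int_minus power_inverse)
  moreover have "Y \<star> (X * ?C) = Y * (X * ?C) + scal ((inverse q)\<^sup>2) (X * (Y \<star> ?C))"
    by (simp add: letter_shuffle_Cons power_int_minus power_inverse)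
  ultimately show ?thesis
    using q_nonzero
    by (simp add: scal_add_right scal_diff_right right_diff_distrib scal_mult_right flip: power_mult_distrib)
qed

lemma X_shuffle_CY:
  "X \<star> (catalan_elt q n * Y) - scal ((inverse q)\<^sup>2) ((catalan_elt q n * Y) \<star> X)
     = scal ((inverse q)\<^sup>2 * \<kappa>) (catalan_elt q (Suc n))"
proof -
  let ?D = "catalan_elt q n * Y"
  have "scal (q\<^sup>2) (X \<star> ?D) - ?D \<star> X = scal \<kappa> (catalan_elt q (Suc n))"
    using letter_X_shuffle_catalan_path[of 0 "2 * n"]
    by (simp add: catalan_elt_conv_path qint_simps del: catalan_path.simps)
  then have "scal ((inverse q)\<^sup>2) (scal (q\<^sup>2) (X \<star> ?D) - ?D \<star> X) = scal ((inverse q)\<^sup>2 * \<kappa>) (catalan_elt q (Suc n))"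
    by simp
  then show ?thesis
    using q_nonzero by (simp add: scal_diff_right flip: power_mult_distrib)
qed

lemma catalan_elt_commutes_XY: "catalan_elt q n \<star> (X * Y) = (X * Y) \<star> catalan_elt q n"
  using catalan_path_shuffle_XY[of "2 * n" 0]
    catalan_path_minus_one[of "Suc (2 * n)"]
  by (simp add: catalan_elt_conv_path shuffle_linear qint_simps
      del: catalan_path.simps)

text \<open>
  Splitting by the first letter turns the commutator into \<open>x\<close> times the commutator of \<open>C\<^sub>n\<close> with
  \<open>xy\<close>, which is zero, plus \<open>x\<close> times the combination in \<open>XC_shuffle_Y\<close>.
\<close>

lemma XC_commutator_XY:
  "(X * catalan_elt q n) \<star> (X * Y) - (X * Y) \<star> (X * catalan_elt q n)
     = scal \<kappa> (X * catalan_elt q (Suc n))"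
proof -
  let ?C = "catalan_elt q n"
  have "(X * ?C) \<star> (X * Y) = X * (?C \<star> (X * Y)) + scal (q\<^sup>2) (X * ((X * ?C) \<star> Y))"
    using shuffle_Cons_Cons[OF homog_catalan_elt[of n], of q LetX LetX Y] by (simp del: word_mult)
  moreover have "(X * Y) \<star> (X * ?C) = X * (Y \<star> (X * ?C)) + X * ((X * Y) \<star> ?C)"
    using shuffle_Cons_Cons[of "-1" Y q LetX LetX ?C] by (simp del: word_mult)
  ultimately have "(X * ?C) \<star> (X * Y) - (X * Y) \<star> (X * ?C)
      = scal (q\<^sup>2) (X * ((X * ?C) \<star> Y - scal ((inverse q)\<^sup>2) (Y \<star> (X * ?C))))"
    using q_nonzero
    by (simp add: catalan_elt_commutes_XY scal_diff_right right_diff_distrib scal_mult_right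
      del: word_mult flip: power_mult_distrib)
  then show ?thesis
    using q_nonzero
    by (simp add: XC_shuffle_Y scal_mult_right del: word_mult flip: power_mult_distrib mult.assoc)
qed

text \<open>
  The same argument at the other end: splitting by the last letter leaves the combination in
  \<open>X_shuffle_CY\<close>, followed by \<open>y\<close>.
\<close>

lemma CY_commutator_XY:
  "(X * Y) \<star> (catalan_elt q n * Y) - (catalan_elt q n * Y) \<star> (X * Y)
     = scal \<kappa> (catalan_elt q (Suc n) * Y)"
proof -
  let ?C = "catalan_elt q n"
  have "(?C * Y) \<star> (X * Y) = ((?C * Y) \<star> X) * Y + (?C \<star> (X * Y)) * Y"
    using shuffle_snoc_snoc[OF q_nonzero, of 1 X ?C LetY LetY] by (simp del: word_mult)
  moreover have "(X * Y) \<star> (?C * Y) = ((X * Y) \<star> ?C) * Y + scal (q\<^sup>2) ((X \<star> (?C * Y)) * Y)"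
    using shuffle_snoc_snoc[OF q_nonzero homog_catalan_elt[of n], of X LetY LetY] by (simp del: word_mult)
  ultimately have "(X * Y) \<star> (?C * Y) - (?C * Y) \<star> (X * Y)
      = scal (q\<^sup>2) (X \<star> (?C * Y) - scal ((inverse q)\<^sup>2) ((?C * Y) \<star> X)) * Y"
    using q_nonzero
    by (simp add: catalan_elt_commutes_XY scal_diff_right left_diff_distrib scal_mult_left
      del: word_mult flip: power_mult_distrib)
  then show ?thesis
    using q_nonzero
    by (simp add: X_shuffle_CY scal_mult_left del: word_mult flip: power_mult_distrib mult.assoc)
qed

end

section \<open>The presented algebra\<close>

lemma free_alg_simps [simp]:
  "carrier free_alg = UNIV" "mult free_alg = (*)" "one free_alg = 1" "zero free_alg = 0"
  "add free_alg = (+)" "smult free_alg = scal"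
  by (simp_all add: free_alg_def)

lemma shuffle_alg_simps [simp]:
  "carrier (shuffle_alg q) = UNIV" "mult (shuffle_alg q) = q_shuffle q" "one (shuffle_alg q) = 1"
  "zero (shuffle_alg q) = 0" "add (shuffle_alg q) = (+)" "smult (shuffle_alg q) = scal"
  by (simp_all add: shuffle_alg_def)

lemma ring_free_alg: "ring (free_alg :: ('f::field, 'g list \<Rightarrow>\<^sub>0 'f) module)"
proof (rule ringI)
  show "abelian_group (free_alg :: ('f, 'g list \<Rightarrow>\<^sub>0 'f) module)"
    by (rule abelian_groupI) (auto simp: add_ac intro: exI[of _ "- x" for x])
  show "monoid (free_alg :: ('f, 'g list \<Rightarrow>\<^sub>0 'f) module)"
    by (rule monoidI) (auto simp: mult.assoc)
qed (auto simp: algebra_simps)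

lemma free_alg_minus:
  fixes f g :: "'g list \<Rightarrow>\<^sub>0 'f::field"
  shows "f \<ominus>\<^bsub>free_alg\<^esub> g = f - g"
proof -
  interpret ring "free_alg :: ('f, 'g list \<Rightarrow>\<^sub>0 'f) module" by (rule ring_free_alg)
  have "\<ominus>\<^bsub>free_alg\<^esub> g = - g"
    by (rule minus_equality) auto
  then show ?thesis by (simp add: a_minus_def)
qed

lemma quot_alg_simps [simp]:
  "carrier (quot_alg M I) = carrier (M Quot I)" "mult (quot_alg M I) = mult (M Quot I)"
  "one (quot_alg M I) = one (M Quot I)" "zero (quot_alg M I) = zero (M Quot I)"
  "add (quot_alg M I) = add (M Quot I)"
  "smult (quot_alg M I) = (\<lambda>c Z. \<Union>z\<in>Z. I +>\<^bsub>M\<^esub> (c \<odot>\<^bsub>M\<^esub> z))"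
  by (simp_all add: quot_alg_def ring.extend_def module.fields_def)

lemma ring_quot_alg:
  assumes "ideal I M"
  shows "ring (quot_alg M I)"
proof -
  interpret Q: ring "M Quot I"
    by (rule ideal.quotient_is_ring[OF assms])
  show ?thesis
  proof (rule ringI)
    show "abelian_group (quot_alg M I)"
      by (rule abelian_groupI) (auto simp: Q.a_ac intro: Q.l_neg Q.a_inv_closed)
    show "monoid (quot_alg M I)"
      by (rule monoidI) (auto simp: Q.m_assoc)
  qed (auto simp: Q.l_distr Q.r_distr)
qed

lemma scal_minus_one: "scal (-1) f = - f"
  by (rule poly_mapping_eqI) simp

lemma ideal_uq_ideal: "ideal (uq_ideal q) free_alg"
  unfolding uq_ideal_def by (rule ring.genideal_ideal[OF ring_free_alg]) simp

lemma uq_ideal_scal: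
  assumes "f \<in> uq_ideal q"
  shows "scal c f \<in> uq_ideal q"
  using ideal.I_l_closed[OF ideal_uq_ideal assms, of "Poly_Mapping.single [] c"]
  by (simp add: scal_conv_mult)

definition uq_class :: "'f::field \<Rightarrow> (uq_gen list \<Rightarrow>\<^sub>0 'f) \<Rightarrow> (uq_gen list \<Rightarrow>\<^sub>0 'f) set" where
  "uq_class q f = uq_ideal q +>\<^bsub>free_alg\<^esub> f"

lemma uq_class_eq: "uq_class q f = {i + f | i. i \<in> uq_ideal q}"
  by (auto simp: uq_class_def a_r_coset_def r_coset_def)

lemma uq_class_eqI:
  assumes "f - g \<in> uq_ideal q"
  shows "uq_class q f = uq_class q g"
proof -
  note a_closed = additive_subgroup.a_closed[OF ideal.axioms(1)[OF ideal_uq_ideal, of q]]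
  have closed: "i + j \<in> uq_ideal q" "i - j \<in> uq_ideal q"
    if "i \<in> uq_ideal q" "j \<in> uq_ideal q" for i j
    using a_closed[of i j] a_closed[of i "- j"] uq_ideal_scal[OF that(2), of "-1"] that
    by (simp_all add: scal_minus_one)
  have "i + f = (i + (f - g)) + g" "i + g = (i - (f - g)) + f" for i
    by simp_all
  then show ?thesis
    unfolding uq_class_eq using closed assms by blast
qed

lemma ring_Uq_plus: "ring (Uq_plus q)"
  unfolding Uq_plus_def by (rule ring_quot_alg[OF ideal_uq_ideal])

lemma carrier_Uq_plus: "carrier (Uq_plus q) = range (uq_class q)"
  by (auto simp: Uq_plus_def FactRing_def A_RCOSETS_defs uq_class_def a_r_coset_def)

lemma uq_class_hom: "uq_class q \<in> ring_hom free_alg (Uq_plus q)"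
proof -
  have "uq_class q = (+>\<^bsub>free_alg\<^esub>) (uq_ideal q)"
    by (simp add: fun_eq_iff uq_class_def)
  then show ?thesis
    using ideal.rcos_ring_hom[OF ideal_uq_ideal, of q] by (simp add: ring_hom_def Uq_plus_def)
qed

lemma uq_class_smult: "c \<odot>\<^bsub>Uq_plus q\<^esub> uq_class q f = uq_class q (scal c f)"
proof -
  have "uq_class q (scal c (i + f)) = uq_class q (scal c f)" if "i \<in> uq_ideal q" for i
    by (rule uq_class_eqI) (simp add: scal_add_right uq_ideal_scal that)
  moreover have "0 \<in> uq_ideal q"
    using additive_subgroup.zero_closed[OF ideal.axioms(1)[OF ideal_uq_ideal]] by simp
  ultimately show ?thesis
    by (auto simp: Uq_plus_def uq_class_eq[of q f] simp flip: uq_class_def)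
qed

lemma uq_class_ops:
  "uq_class q f \<otimes>\<^bsub>Uq_plus q\<^esub> uq_class q g = uq_class q (f * g)"
  "uq_class q f \<oplus>\<^bsub>Uq_plus q\<^esub> uq_class q g = uq_class q (f + g)"
  "uq_class q f \<ominus>\<^bsub>Uq_plus q\<^esub> uq_class q g = uq_class q (f - g)"
proof -
  interpret ring_hom_ring free_alg "Uq_plus q" "uq_class q"
    by (rule ring_hom_ringI2[OF ring_free_alg ring_Uq_plus uq_class_hom])
  show "uq_class q f \<otimes>\<^bsub>Uq_plus q\<^esub> uq_class q g = uq_class q (f * g)"
    using hom_mult[of f g] by simp
  show "uq_class q f \<oplus>\<^bsub>Uq_plus q\<^esub> uq_class q g = uq_class q (f + g)"
    using hom_add[of f g] by simp
  show "uq_class q f \<ominus>\<^bsub>Uq_plus q\<^esub> uq_class q g = uq_class q (f - g)"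
    using hom_add[of f "\<ominus>\<^bsub>free_alg\<^esub> g"] hom_a_inv[of g] free_alg_minus[of f g]
    by (simp add: a_minus_def)
qed

section \<open>The homomorphism to the q-shuffle algebra\<close>

primrec gen_letter :: "uq_gen \<Rightarrow> letter" where
  "gen_letter GenA = LetX" | "gen_letter GenB = LetY"

definition shuffle_eval :: "'f::field \<Rightarrow> (uq_gen list \<Rightarrow>\<^sub>0 'f) \<Rightarrow> (letter list \<Rightarrow>\<^sub>0 'f)" where
  "shuffle_eval q = linear_extension (\<lambda>w. foldr (\<lambda>g f. q_shuffle q (word [gen_letter g]) f) w 1)"

lemma lin_shuffle_eval: "lin A \<Longrightarrow> lin (\<lambda>f. shuffle_eval q (A f))"
  unfolding shuffle_eval_def by (rule lin_comp[OF lin_linear_extension])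

lemmas shuffle_eval_linear =
  lin_add[OF lin_shuffle_eval[OF lin_id]] lin_diff[OF lin_shuffle_eval[OF lin_id]]
  lin_scal[OF lin_shuffle_eval[OF lin_id]] lin_zero[OF lin_shuffle_eval[OF lin_id]]

lemma shuffle_eval_gen [simp]: "shuffle_eval q (word [g]) = word [gen_letter g]"
  by (simp add: shuffle_eval_def shuffle_one_right)

lemma shuffle_eval_one [simp]: "shuffle_eval q 1 = 1"
proof -
  have "shuffle_eval q (word []) = 1"
    by (simp add: shuffle_eval_def)
  then show ?thesis
    by (simp add: word_Nil)
qed

lemma shuffle_eval_mult:
  assumes "q \<noteq> 0"
  shows "shuffle_eval q (f * g) = q_shuffle q (shuffle_eval q f) (shuffle_eval q g)"
    (is "?L f g = ?R f g")
proof (rule lin_eq_on_words[where A = "\<lambda>f. ?L f g" and B = "\<lambda>f. ?R f g"])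
  fix u show "?L (word u) g = ?R (word u) g"
  proof (rule lin_eq_on_words[where A = "\<lambda>g. ?L (word u) g" and B = "\<lambda>g. ?R (word u) g"])
    fix v show "?L (word u) (word v) = ?R (word u) (word v)"
      by (induction u) (simp_all add: shuffle_eval_def shuffle_one_left shuffle_assoc[OF assms])
  qed (intro lin_intros lin_shuffle_eval)+
qed (intro lin_intros lin_shuffle_eval)+

text \<open>
  All four products are combinations of the four words with three letters \<open>a\<close> and one letter \<open>b\<close>,
  with coefficients that are Laurent polynomials in \<open>q\<^sup>2\<close>; they cancel word by word. Both relations
  are covered because the pairing is symmetric in the two letters.
\<close>

lemma q_serre_shuffle:
  assumes "q \<noteq> 0" "q ^ 2 \<noteq> 1" "a \<noteq> b"
  defines "A \<equiv> word [a] :: letter list \<Rightarrow>\<^sub>0 'f::field" and "B \<equiv> word [b]"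
  shows "q_shuffle q A (q_shuffle q A (q_shuffle q A B))
      - scal (qint q 3) (q_shuffle q A (q_shuffle q A (q_shuffle q B A)))
      + scal (qint q 3) (q_shuffle q A (q_shuffle q B (q_shuffle q A A)))
      - q_shuffle q B (q_shuffle q A (q_shuffle q A A)) = 0"
proof -
  interpret nondegenerate_q q by unfold_locales fact+
  have p: "pairing a a = 2" "pairing b b = 2" "pairing a b = -2" "pairing b a = -2"
    using assms by (auto simp: pairing_def)
  have "\<kappa> * qint q 3 = \<kappa> * (q\<^sup>2 + 1 + (inverse q)\<^sup>2)"
    unfolding kappa_qint using q_nonzero
    by (simp add: power_int_minus field_simps power2_eq_square power3_eq_cube)
  then have q3: "qint q 3 = q\<^sup>2 + 1 + (inverse q)\<^sup>2"
    using kappa_nonzero by simp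
  define Q where "Q = q\<^sup>2"
  have Q: "q powi pairing a a = Q" "q powi pairing b b = Q"
    "q powi pairing a b = inverse Q" "q powi pairing b a = inverse Q" "Q \<noteq> 0"
    using q_nonzero by (simp_all add: p Q_def power_int_minus)
  have q3: "qint q 3 = Q + 1 + inverse Q"
    using q3 by (simp add: Q_def power_inverse)
  show ?thesis
    unfolding A_def B_def q3
    by (rule poly_mapping_eqI)
      (simp add: Q lookup_simps del: lookup_single_eq, simp add: Q field_simps)
qed


lemma ring_shuffle_alg:
  assumes "q \<noteq> 0"
  shows "ring (shuffle_alg q)"
proof (rule ringI)
  show "abelian_group (shuffle_alg q)"
    by (rule abelian_groupI) (auto simp: add_ac intro: exI[of _ "- x" for x])
  show "monoid (shuffle_alg q)"
    by (rule monoidI) (auto simp: shuffle_assoc[OF assms] shuffle_one_left shuffle_one_right)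
qed (auto simp: shuffle_linear)

context nondegenerate_q
begin

lemma shuffle_eval_q_serre:
  assumes "g \<noteq> h"
  shows "shuffle_eval q (q_serre q g h) = 0"
proof -
  have "gen_letter g \<noteq> gen_letter h"
    using assms by (cases g; cases h) auto
  from q_serre_shuffle[OF q_nonzero q_square this] show ?thesis
    by (simp add: q_serre_def Let_def power2_eq_square power3_eq_cube shuffle_eval_linear
        shuffle_eval_mult[OF q_nonzero] shuffle_assoc[OF q_nonzero] del: word_mult shuffle_word_word)
qed

lemma shuffle_eval_uq_ideal:
  assumes "f \<in> uq_ideal q"
  shows "shuffle_eval q f = 0"
proof -
  have "ring_hom_ring free_alg (shuffle_alg q) (shuffle_eval q)"
    by (rule ring_hom_ringI[OF ring_free_alg ring_shuffle_alg[OF q_nonzero]])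
      (simp_all add: shuffle_eval_mult[OF q_nonzero] shuffle_eval_linear)
  then have "ideal (a_kernel free_alg (shuffle_alg q) (shuffle_eval q)) free_alg"
    by (rule ring_hom_ring.kernel_is_ideal)
  moreover have kernel: "a_kernel free_alg (shuffle_alg q) (shuffle_eval q) = {f. shuffle_eval q f = 0}"
    by (simp add: a_kernel_def')
  ultimately have "uq_ideal q \<subseteq> {f. shuffle_eval q f = 0}"
    unfolding uq_ideal_def
    by (intro ring.genideal_minimal[OF ring_free_alg]) (simp_all add: shuffle_eval_q_serre)
  then show ?thesis
    using assms by auto
qed

lemma alg_hom_determined:
  assumes h: "h \<in> alg_hom (Uq_plus q) (shuffle_alg q)"
    and gens: "h (uqA q) = X" "h (uqB q) = Y"
  shows "h (uq_class q f) = shuffle_eval q f"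
proof -
  have in_carrier: "uq_class q f \<in> carrier (Uq_plus q)" for f
    by (simp add: carrier_Uq_plus)
  have hom: "h \<in> ring_hom (Uq_plus q) (shuffle_alg q)"
    and smult: "h (c \<odot>\<^bsub>Uq_plus q\<^esub> uq_class q f) = scal c (h (uq_class q f))" for c f
    using h in_carrier by (auto simp: alg_hom_def)
  have add: "h (uq_class q (f + g)) = h (uq_class q f) + h (uq_class q g)" for f g
    using ring_hom_add[OF hom in_carrier in_carrier, of f g] by (simp add: uq_class_ops)
  have mult: "h (uq_class q (f * g)) = h (uq_class q f) \<star> h (uq_class q g)" for f g
    using ring_hom_mult[OF hom in_carrier in_carrier, of f g] by (simp add: uq_class_ops)
  have one: "h (uq_class q 1) = 1"
    using ring_hom_one[OF hom] unfolding ring_hom_one[OF uq_class_hom, of q, symmetric, simplified]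
    by simp
  have gen: "h (uq_class q (word [g])) = word [gen_letter g]" for g
    using gens by (cases g) (simp_all add: uq_gen_elt_def uq_class_def)
  show ?thesis
  proof (rule lin_eq_on_words[where A = "\<lambda>f. h (uq_class q f)" and B = "shuffle_eval q" and f = f])
    show "lin (\<lambda>f. h (uq_class q f))"
      by (rule linI) (simp_all only: add smult uq_class_smult[symmetric])
    show "lin (shuffle_eval q)"
      by (rule lin_shuffle_eval[OF lin_id])
    fix w show "h (uq_class q (word w)) = shuffle_eval q (word w)"
    proof (induction w)
      case Nil
      then show ?case by (simp add: word_Nil one)
    next
      case (Cons g w)
      then show ?case
        unfolding word_Cons[of g w]
        by (simp add: mult gen shuffle_eval_mult[OF q_nonzero] del: word_mult shuffle_word_word)
    qed
  qed
qed

text \<open>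
  Evaluation of representatives is well defined on classes and is a homomorphism with the required
  values on the generators; by \<open>alg_hom_determined\<close> it is the only one. So the definite description
  that defines \<open>natural\<close> denotes this map.
\<close>

lemma natural_class: "natural q (uq_class q f) = shuffle_eval q f"
proof -
  define P where "P h \<longleftrightarrow> h \<in> alg_hom (Uq_plus q) (shuffle_alg q)
      \<and> h \<in> extensional (carrier (Uq_plus q)) \<and> h (uqA q) = X \<and> h (uqB q) = Y" for h
  define h where "h = restrict (\<lambda>Z. shuffle_eval q (SOME f. f \<in> Z)) (carrier (Uq_plus q))"
  have h_class: "h (uq_class q f) = shuffle_eval q f" for f
  proof -
    have "0 \<in> uq_ideal q"
      using additive_subgroup.zero_closed[OF ideal.axioms(1)[OF ideal_uq_ideal]] by simp
    then have "f \<in> uq_class q f"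
      by (force simp: uq_class_eq)
    then have "(SOME f'. f' \<in> uq_class q f) \<in> uq_class q f"
      by (rule someI)
    then show ?thesis
      by (auto simp: h_def carrier_Uq_plus uq_class_eq shuffle_eval_linear shuffle_eval_uq_ideal)
  qed
  have "P h"
    unfolding P_def
  proof (intro conjI)
    show "h \<in> extensional (carrier (Uq_plus q))"
      by (simp add: h_def)
    show "h (uqA q) = X" "h (uqB q) = Y"
      using h_class[of "word [GenA]"] h_class[of "word [GenB]"]
      by (simp_all add: uq_class_def uq_gen_elt_def)
    have "h \<in> ring_hom (Uq_plus q) (shuffle_alg q)"
    proof (rule ring_hom_memI)
      show "h \<one>\<^bsub>Uq_plus q\<^esub> = \<one>\<^bsub>shuffle_alg q\<^esub>"
        using h_class[of 1] ring_hom_one[OF uq_class_hom, of q] by simp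
    qed (auto simp: carrier_Uq_plus uq_class_ops h_class shuffle_eval_mult[OF q_nonzero]
        shuffle_eval_linear)
    then show "h \<in> alg_hom (Uq_plus q) (shuffle_alg q)"
      by (auto simp: alg_hom_def carrier_Uq_plus uq_class_smult h_class shuffle_eval_linear)
  qed
  moreover have "h' = h" if "P h'" for h'
  proof (rule extensionalityI[of _ "carrier (Uq_plus q)"])
    show "h' \<in> extensional (carrier (Uq_plus q))" "h \<in> extensional (carrier (Uq_plus q))"
      using \<open>P h\<close> that by (auto simp: P_def)
    fix Z assume "Z \<in> carrier (Uq_plus q)"
    then show "h' Z = h Z"
      using that alg_hom_determined[of h'] by (auto simp: P_def carrier_Uq_plus h_class)
  qed
  ultimately have "natural q = h"
    unfolding natural_def P_def[symmetric] by (rule the_equality)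
  then show ?thesis
    by (simp add: h_class)
qed

lemma natural_simps:
  assumes "Z \<in> carrier (Uq_plus q)" "W \<in> carrier (Uq_plus q)"
  shows "natural q (Z \<otimes>\<^bsub>Uq_plus q\<^esub> W) = natural q Z \<star> natural q W"
    "natural q (Z \<ominus>\<^bsub>Uq_plus q\<^esub> W) = natural q Z - natural q W"
  using assms
  by (auto simp: carrier_Uq_plus uq_class_ops natural_class shuffle_eval_linear
      shuffle_eval_mult[OF q_nonzero])

lemma natural_smult:
  "Z \<in> carrier (Uq_plus q) \<Longrightarrow> natural q (c \<odot>\<^bsub>Uq_plus q\<^esub> Z) = scal c (natural q Z)"
  by (auto simp: carrier_Uq_plus uq_class_smult natural_class shuffle_eval_linear)

lemma Uq_plus_smult_closed:
  "Z \<in> carrier (Uq_plus q) \<Longrightarrow> c \<odot>\<^bsub>Uq_plus q\<^esub> Z \<in> carrier (Uq_plus q)"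
  by (auto simp: carrier_Uq_plus uq_class_smult)

lemma Uq_plus_closed:
  assumes "Z \<in> carrier (Uq_plus q)" "W \<in> carrier (Uq_plus q)"
  shows "Z \<otimes>\<^bsub>Uq_plus q\<^esub> W \<in> carrier (Uq_plus q)" "Z \<ominus>\<^bsub>Uq_plus q\<^esub> W \<in> carrier (Uq_plus q)"
  using assms by (auto simp: carrier_Uq_plus uq_class_ops)

lemma uq_gen_closed: "uq_gen_elt q g \<in> carrier (Uq_plus q)"
  by (auto simp: carrier_Uq_plus uq_gen_elt_def uq_class_def)

lemma natural_gen: "natural q (uqA q) = X" "natural q (uqB q) = Y"
  using natural_class[of "word [GenA]"] natural_class[of "word [GenB]"]
  by (simp_all add: uq_class_def uq_gen_elt_def)

lemmas natural_rules = natural_simps natural_smult Uq_plus_closed Uq_plus_smult_closed uq_gen_closed natural_gen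

end

section \<open>The images of Damiani's elements\<close>

context nondegenerate_q
begin

lemma natural_E_delta_1:
  "E_delta_1 q \<in> carrier (Uq_plus q)"
  "natural q (E_delta_1 q) = scal (- ((inverse q)\<^sup>2 * \<kappa> * (q + inverse q))) (X * Y)"
proof -
  show "E_delta_1 q \<in> carrier (Uq_plus q)"
    by (simp add: E_delta_1_def natural_rules)
  have "natural q (E_delta_1 q) = scal ((inverse q)\<^sup>2) (Y \<star> X) - X \<star> Y"
    by (simp add: E_delta_1_def natural_rules power_int_minus power_inverse del: shuffle_word_word)
  also have "\<dots> = scal ((inverse q)\<^sup>2 * (inverse q)\<^sup>2 - 1) (X * Y)"
    by (rule poly_mapping_eqI)
      (simp add: lookup_simps pairing_def power_int_minus power_inverse algebra_simps)
  also have "(inverse q)\<^sup>2 * (inverse q)\<^sup>2 - 1 = - ((inverse q)\<^sup>2 * \<kappa> * (q + inverse q))"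
    using q_nonzero by (simp add: field_simps power2_eq_square)
  finally show "natural q (E_delta_1 q) = scal (- ((inverse q)\<^sup>2 * \<kappa> * (q + inverse q))) (X * Y)" .
qed

lemma normalise_coefficient:
  "e \<noteq> 0 \<Longrightarrow> inverse e * ((inverse q)\<^sup>2 * \<kappa> * e * t) * \<kappa> = (inverse q)\<^sup>2 * \<kappa>\<^sup>2 * t"
  by (simp add: power2_eq_square)

lemma natural_E_delta_alpha0:
  assumes "q + inverse q \<noteq> 0"
  shows "E_delta_alpha0 q n \<in> carrier (Uq_plus q)
    \<and> natural q (E_delta_alpha0 q n) = scal (((inverse q)\<^sup>2 * \<kappa>\<^sup>2) ^ n) (X * catalan_elt q n)"
proof (induction n)
  case 0
  then show ?case
    by (simp add: natural_rules catalan_elt_conv_path)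
next
  case (Suc n)
  let ?t = "(inverse q)\<^sup>2 * \<kappa>\<^sup>2" and ?e = "q + inverse q"
  have "natural q (E_delta_alpha0 q (Suc n))
      = scal (inverse ?e * ((inverse q)\<^sup>2 * \<kappa> * ?e * ?t ^ n))
          ((X * catalan_elt q n) \<star> (X * Y) - (X * Y) \<star> (X * catalan_elt q n))"
    using Suc
    by (intro poly_mapping_eqI)
      (simp add: commutator_def natural_rules natural_E_delta_1 lookup_simps algebra_simps
        del: word_mult)
  also have "\<dots> = scal (?t ^ Suc n) (X * catalan_elt q (Suc n))"
    by (simp only: XC_commutator_XY scal_scal normalise_coefficient[OF assms] power_Suc)
  finally show ?case
    using Suc by (simp add: commutator_def natural_rules natural_E_delta_1)
qed

lemma natural_E_delta_alpha1:
  assumes "q + inverse q \<noteq> 0"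
  shows "E_delta_alpha1 q n \<in> carrier (Uq_plus q)
    \<and> natural q (E_delta_alpha1 q n) = scal (((inverse q)\<^sup>2 * \<kappa>\<^sup>2) ^ n) (catalan_elt q n * Y)"
proof (induction n)
  case 0
  then show ?case
    by (simp add: natural_rules catalan_elt_conv_path)
next
  case (Suc n)
  let ?t = "(inverse q)\<^sup>2 * \<kappa>\<^sup>2" and ?e = "q + inverse q"
  have "natural q (E_delta_alpha1 q (Suc n))
      = scal (inverse ?e * ((inverse q)\<^sup>2 * \<kappa> * ?e * ?t ^ n))
          ((X * Y) \<star> (catalan_elt q n * Y) - (catalan_elt q n * Y) \<star> (X * Y))"
    using Suc
    by (intro poly_mapping_eqI)
      (simp add: commutator_def natural_rules natural_E_delta_1 lookup_simps algebra_simps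
        del: word_mult)
  also have "\<dots> = scal (?t ^ Suc n) (catalan_elt q (Suc n) * Y)"
    by (simp only: CY_commutator_XY scal_scal normalise_coefficient[OF assms] power_Suc)
  finally show ?case
    using Suc by (simp add: commutator_def natural_rules natural_E_delta_1)
qed

lemma natural_E_delta_Suc:
  assumes "q + inverse q \<noteq> 0"
  shows "natural q (E_delta q (Suc n))
    = scal (- (((inverse q)\<^sup>2 * \<kappa>\<^sup>2) ^ n * ((inverse q)\<^sup>2 * \<kappa>))) (catalan_elt q (Suc n))"
proof -
  let ?D = "catalan_elt q n * Y" and ?t = "(inverse q)\<^sup>2 * \<kappa>\<^sup>2"
  note E = natural_E_delta_alpha1[OF assms, of n]
  have "natural q (E_delta q (Suc n))
      = scal (- (?t ^ n)) (X \<star> ?D - scal ((inverse q)\<^sup>2) (?D \<star> X))"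
    using E by (intro poly_mapping_eqI)
      (simp add: E_delta_def natural_rules lookup_simps power_int_minus power_inverse algebra_simps)
  then show ?thesis
    by (simp add: X_shuffle_CY)
qed

end

theorem theorem1p7:
  fixes q :: "'f::field"
  assumes "q \<noteq> 0"
    and "\<And>k::nat. k \<ge> 1 \<Longrightarrow> q ^ k \<noteq> 1"
  shows "(\<forall>n::nat.
            natural q (E_delta_alpha0 q n) =
              scal (q powi (- 2 * int n) * (q - inverse q) ^ (2 * n)) (word [LetX] * catalan_elt q n)
          \<and> natural q (E_delta_alpha1 q n) =
              scal (q powi (- 2 * int n) * (q - inverse q) ^ (2 * n)) (catalan_elt q n * word [LetY]))
       \<and> (\<forall>n::nat. n \<ge> 1 \<longrightarrow>
            natural q (E_delta q n) =
              scal (- (q powi (- 2 * int n)) * (q - inverse q) ^ (2 * n - 1)) (catalan_elt q n))"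
proof -
  interpret nondegenerate_q q
    using assms(1) assms(2)[of 2] by unfold_locales auto
  \<comment> \<open>otherwise \<open>q\<close> would be a root of unity of order dividing \<open>4\<close>\<close>
  have "q + inverse q \<noteq> 0"
  proof
    assume "q + inverse q = 0"
    then have "q ^ 2 = -1"
      using assms(1) by (simp add: power2_eq_square field_simps eq_neg_iff_add_eq_0)
    then have "(q ^ 2) ^ 2 = 1"
      by simp
    then show False
      using assms(2)[of 4] by simp
  qed
  note natural_E = natural_E_delta_alpha0[OF this] natural_E_delta_alpha1[OF this]
    natural_E_delta_Suc[OF this]
  have powi: "q powi (- 2 * int n) = ((inverse q)\<^sup>2) ^ n" for n
    by (simp add: power_int_minus power_inverse power_mult power_int_def nat_mult_distrib)
  have coeff: "q powi (- 2 * int n) * \<kappa> ^ (2 * n) = ((inverse q)\<^sup>2 * \<kappa>\<^sup>2) ^ n" for n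
    by (simp only: powi power_mult_distrib power_mult)
  have coeff': "- (q powi (- 2 * int (Suc n))) * \<kappa> ^ (2 * Suc n - 1)
      = - (((inverse q)\<^sup>2 * \<kappa>\<^sup>2) ^ n * ((inverse q)\<^sup>2 * \<kappa>))" for n
  proof -
    have "2 * Suc n - 1 = Suc (2 * n)"
      by simp
    then show ?thesis
      by (simp only: powi power_Suc power_mult power_mult_distrib) (simp add: mult_ac)
  qed
  have "natural q (E_delta q n)
      = scal (- (q powi (- 2 * int n)) * \<kappa> ^ (2 * n - 1)) (catalan_elt q n)" if n: "n \<ge> 1" for n
  proof -
    from n obtain m where "n = Suc m"
      by (cases n) auto
    then show ?thesis
      by (simp only: coeff' natural_E)
  qed
  then show ?thesis
    by (simp only: coeff natural_E simp_thms) blast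
qed

end
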